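(* Let $\widehat E=E+\varepsilon E_0$ and $\widehat F=F+\varepsilon F_0$ be elements of $\mathbb{D}_n^{\rm CM}$, with $\mathrm{rk}(E)=r_e$ and $\mathrm{rk}(F)=r_f$. Then $\widehat E\overset{{\rm DM}\text{-}\#}{\leq}\widehat F$ (Dual-minus sharp order) if and only if there is a nonsingular matrix $P\in\mathbb{R}^{n\times n}$ such that $$\widehat E=P\begin{pmatrix} D_1 & O & O \\ O & O & O \\ O & O & O \end{pmatrix}P^{-1}+\varepsilon P\begin{pmatrix} E_1 & E_2 & E_3 \\ E_4 & O & O \\ E_7 & O & O \end{pmatrix}P^{-1},$$ $$\widehat F=P\begin{pmatrix} D_1 & O & O \\ O & D_2 & O \\ O & O & O \end{pmatrix}P^{-1}+\varepsilon P\begin{pmatrix} E_1 & F_2 & E_3 \\ F_4 & F_5 & F_6 \\ E_7 & F_8 & O \end{pmatrix}P^{-1},$$ where $D_1\in\mathbb{R}^{r_e\times r_e}$ and $D_2\in\mathbb{R}^{(r_f-r_e)\times(r_f-r_e)}$ are nonsingular matrices and the remaining blocks $E_i,F_i$ are real matrices of conformable sizes.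
   Context: $\varepsilon$ is the dual unit: $\varepsilon\neq 0$, $\varepsilon^2=0$, commuting with reals. $\mathbb{D}^{m\times n}$ is the set of $m\times n$ dual matrices $\widehat E=E+\varepsilon E_0$ with $E,E_0\in\mathbb{R}^{m\times n}$, with the obvious addition, multiplication and transpose $\widehat E^{T}=E^T+\varepsilon E_0^T$. The dual Moore-Penrose generalized inverse (DMPGI) of $\widehat E\in\mathbb{D}^{m\times n}$ is the unique $\widehat X\in\mathbb{D}^{n\times m}$, if it exists, with $\widehat E\widehat X\widehat E=\widehat E$, $\widehat X\widehat E\widehat X=\widehat X$, $(\widehat E\widehat X)^T=\widehat E\widehat X$, $(\widehat X\widehat E)^T=\widehat X\widehat E$. The dual group generalized inverse (DGGI) of $\widehat E\in\mathbb{D}^{n\times n}$ is the $\widehat X\in\mathbb{D}^{n\times n}$, if it exists, with $\widehat E\widehat X\widehat E=\widehat E$, $\widehat X\widehat E\widehat X=\widehat X$, $\widehat E\widehat X=\widehat X\widehat E$. $\mathbb{D}_n^{\rm CM}$ is the set of dual matrices in $\mathbb{D}^{n\times n}$ of dual index one, i.e. (equivalently) those whose DGGI exists; for $\widehat E=E+\varepsilon E_0\in\mathbb{D}_n^{\rm CM}$ the DMPGI of $\widehat E$ exists and $\mathrm{rk}(E^2)=\mathrm{rk}(E)$. Sharp partial order: for real $n\times n$ matrices $E,F$ with $\mathrm{rk}(E^2)=\mathrm{rk}(E)$ and $\mathrm{rk}(F^2)=\mathrm{rk}(F)$, $E\overset{\#}{\leq}F$ means $EF=E^2=FE$. Dual-minus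 sharp order: for $\widehat E,\widehat F\in\mathbb{D}_n^{\rm CM}$, $\widehat E\overset{{\rm DM}\text{-}\#}{\leq}\widehat F$ means that $E\overset{\#}{\leq}F$ and the DMPGI of $\widehat F-\widehat E$ exists. All $3\times3$ block matrices are partitioned with block-row and block-column sizes $r_e,\ r_f-r_e,\ n-r_f$; $O$ denotes zero blocks, and blocks of size zero are allowed. *)

theory Defs
  imports "Jordan_Normal_Form.DL_Rank" "Jordan_Normal_Form.Gauss_Jordan_Elimination"
begin

section \<open>Dual numbers\<close>

datatype dual_num = Dual (std: real) (inft: real)

instantiation dual_num :: real_algebra_1
begin

definition "0 = Dual 0 0"
definition "1 = Dual 1 0"
definition "x + y = Dual (std x + std y) (inft x + inft y)"
definition "- x = Dual (- std x) (- inft x)"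
definition "x - y = Dual (std x - std y) (inft x - inft y)"
definition "x * y = Dual (std x * std y) (std x * inft y + inft x * std y)"
definition "r *\<^sub>R x = Dual (r * std x) (r * inft x)"

lemmas dual_num_defs =
  zero_dual_num_def one_dual_num_def plus_dual_num_def uminus_dual_num_def
  minus_dual_num_def times_dual_num_def scaleR_dual_num_def

instance
  by standard (auto simp: dual_num_defs algebra_simps)

end

instance dual_num :: comm_ring_1
  by standard (auto simp: dual_num_defs algebra_simps)

definition eps :: dual_num (\<open>\<epsilon>\<close>) where
  "\<epsilon> = Dual 0 1"

lemma eps_nonzero: "\<epsilon> \<noteq> 0" and eps_square: "\<epsilon> * \<epsilon> = 0"
  by (simp_all add: eps_def dual_num_defs)

lemma of_real_dual_num: "of_real r = Dual r 0"
  by (simp add: of_real_def dual_num_defs)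

lemma Dual_eq: "Dual a b = of_real a + \<epsilon> * of_real b"
  by (simp add: of_real_dual_num eps_def dual_num_defs)


section \<open>Dual matrices\<close>

text \<open>Matrices over \<^typ>\<open>dual_num\<close>; addition, multiplication and transposition are those of the
  matrix library. The matrix \<open>A + \<epsilon> A\<^sub>0\<close>:\<close>

definition dual_mat :: "real mat \<Rightarrow> real mat \<Rightarrow> dual_num mat" where
  "dual_mat A A0 = map_mat of_real A + \<epsilon> \<cdot>\<^sub>m map_mat of_real A0"

definition std_part :: "dual_num mat \<Rightarrow> real mat" where
  "std_part A = map_mat std A"

lemma dual_mat_carrier:
  "A0 \<in> carrier_mat m n \<Longrightarrow> dual_mat A A0 \<in> carrier_mat m n"
  by (auto simp: dual_mat_def)

lemma dual_mat_index:
  "i < dim_row A \<Longrightarrow> j < dim_col A \<Longrightarrow> A0 \<in> carrier_mat (dim_row A) (dim_col A) \<Longrightarrow>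
    dual_mat A A0 $$ (i, j) = Dual (A $$ (i, j)) (A0 $$ (i, j))"
  by (auto simp: dual_mat_def Dual_eq)

lemma std_part_dual_mat:
  assumes "A \<in> carrier_mat m n" "A0 \<in> carrier_mat m n"
  shows "std_part (dual_mat A A0) = A"
  by (rule eq_matI) (use assms in \<open>auto simp: std_part_def dual_mat_def of_real_dual_num eps_def dual_num_defs\<close>)

lemma dual_mat_decomp:
  "A = dual_mat (std_part A) (map_mat inft A)"
  by (rule eq_matI) (auto simp: std_part_def dual_mat_def of_real_dual_num eps_def dual_num_defs)


section \<open>Dual generalized inverses\<close>

definition is_DMPGI :: "dual_num mat \<Rightarrow> dual_num mat \<Rightarrow> bool" where
  "is_DMPGI A X \<longleftrightarrow>
     X \<in> carrier_mat (dim_col A) (dim_row A) \<and>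
     A * X * A = A \<and> X * A * X = X \<and>
     transpose_mat (A * X) = A * X \<and> transpose_mat (X * A) = X * A"

definition is_DGGI :: "dual_num mat \<Rightarrow> dual_num mat \<Rightarrow> bool" where
  "is_DGGI A X \<longleftrightarrow>
     square_mat A \<and> X \<in> carrier_mat (dim_row A) (dim_row A) \<and>
     A * X * A = A \<and> X * A * X = X \<and> A * X = X * A"

text \<open>Dual index one is taken as existence of the DGGI (the two are equivalent). The relations below
  carry their domain conditions, so they hold only between matrices of (dual) index one.\<close>

definition DCM :: "nat \<Rightarrow> dual_num mat set" where
  "DCM n = {A \<in> carrier_mat n n. \<exists>X. is_DGGI A X}"


section \<open>Partial orders\<close>

definition sharp_le :: "nat \<Rightarrow> real mat \<Rightarrow> real mat \<Rightarrow> bool" where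
  "sharp_le n A B \<longleftrightarrow>
     A \<in> carrier_mat n n \<and> B \<in> carrier_mat n n \<and>
     vec_space.rank n (A * A) = vec_space.rank n A \<and>
     vec_space.rank n (B * B) = vec_space.rank n B \<and>
     A * B = A * A \<and> A * A = B * A"

definition dm_sharp_le :: "nat \<Rightarrow> dual_num mat \<Rightarrow> dual_num mat \<Rightarrow> bool" where
  "dm_sharp_le n A B \<longleftrightarrow>
     A \<in> DCM n \<and> B \<in> DCM n \<and>
     sharp_le n (std_part A) (std_part B) \<and>
     (\<exists>X. is_DMPGI (B - A) X)"


section \<open>Block matrices\<close>

text \<open>The \<open>3 \<times> 3\<close> block matrix with rows \<open>(A\<^sub>1 A\<^sub>2 A\<^sub>3)\<close>, \<open>(A\<^sub>4 A\<^sub>5 A\<^sub>6)\<close>, \<open>(A\<^sub>7 A\<^sub>8 A\<^sub>9)\<close>: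
  the blocks \<open>A\<^sub>1 A\<^sub>2 A\<^sub>4 A\<^sub>5\<close> are grouped first, and \<open>(A\<^sub>7 A\<^sub>8)\<close> is
  a block matrix with an empty lower block row.\<close>

definition block3_mat ::
  "real mat \<Rightarrow> real mat \<Rightarrow> real mat \<Rightarrow> real mat \<Rightarrow> real mat \<Rightarrow> real mat \<Rightarrow>
   real mat \<Rightarrow> real mat \<Rightarrow> real mat \<Rightarrow> real mat" where
  "block3_mat A1 A2 A3 A4 A5 A6 A7 A8 A9 =
     four_block_mat
       (four_block_mat A1 A2 A4 A5) (A3 @\<^sub>r A6)
       (four_block_mat A7 A8 (0\<^sub>m 0 (dim_col A7)) (0\<^sub>m 0 (dim_col A8))) A9"

lemma block3_mat_carrier:
  assumes "A1 \<in> carrier_mat p p" "A5 \<in> carrier_mat q q" "A9 \<in> carrier_mat r r"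
  shows "block3_mat A1 A2 A3 A4 A5 A6 A7 A8 A9 \<in> carrier_mat (p + q + r) (p + q + r)"
  using assms by (auto simp: block3_mat_def)

lemma block3_mat_index:
  assumes "A1 \<in> carrier_mat p p" "A2 \<in> carrier_mat p q" "A3 \<in> carrier_mat p r"
    and "A4 \<in> carrier_mat q p" "A5 \<in> carrier_mat q q" "A6 \<in> carrier_mat q r"
    and "A7 \<in> carrier_mat r p" "A8 \<in> carrier_mat r q" "A9 \<in> carrier_mat r r"
    and "i < p + q + r" "j < p + q + r"
  shows "block3_mat A1 A2 A3 A4 A5 A6 A7 A8 A9 $$ (i, j) =
    (if i < p then
       if j < p then A1 $$ (i, j)
       else if j < p + q then A2 $$ (i, j - p) else A3 $$ (i, j - (p + q))
     else if i < p + q then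
       if j < p then A4 $$ (i - p, j)
       else if j < p + q then A5 $$ (i - p, j - p) else A6 $$ (i - p, j - (p + q))
     else
       if j < p then A7 $$ (i - (p + q), j)
       else if j < p + q then A8 $$ (i - (p + q), j - p) else A9 $$ (i - (p + q), j - (p + q)))"
  using assms by (auto simp: block3_mat_def append_rows_def)

text \<open>The inverse of a nonsingular matrix; unspecified if the matrix is singular.\<close>

definition inv_mat :: "real mat \<Rightarrow> real mat" where
  "inv_mat P = the (mat_inverse P)"

lemma inv_mat:
  assumes P: "P \<in> carrier_mat n n" and inv: "invertible_mat P"
  shows "inv_mat P \<in> carrier_mat n n" "P * inv_mat P = 1\<^sub>m n" "inv_mat P * P = 1\<^sub>m n"
proof -
  obtain B where B: "P * B = 1\<^sub>m n" "B * P = 1\<^sub>m (dim_row B)"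
    using P inv by (auto simp: invertible_mat_def inverts_mat_def)
  have "dim_col (P * B) = n" "dim_col (B * P) = dim_row B"
    by (simp_all only: B index_one_mat)
  hence "B \<in> carrier_mat n n"
    using P by (metis B(2) carrier_matD(2) carrier_matI index_mult_mat(3))
  hence "P \<in> Units (ring_mat TYPE(real) n ())"
    using P B by (auto simp: Units_def ring_mat_def)
  then obtain Q where "mat_inverse P = Some Q"
    using mat_inverse(1)[OF P, of "()"] by (cases "mat_inverse P") auto
  thus "inv_mat P \<in> carrier_mat n n" "P * inv_mat P = 1\<^sub>m n" "inv_mat P * P = 1\<^sub>m n"
    using mat_inverse(2)[OF P] by (auto simp: inv_mat_def)
qed

end

theory Submission
  imports Defs
begin

text \<open>The real parts satisfy \<open>E F = E\<^sup>2 = F E\<close> exactly when the idempotents \<open>U = E E\<^sup>#\<close> and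
  \<open>V = F F\<^sup>#\<close> satisfy \<open>U F = E = F U\<close>; then \<open>U\<close>, \<open>V - U\<close> and \<open>I - V\<close> are orthogonal idempotents
  summing to \<open>I\<close>, and bases of their ranges are the columns of \<open>P\<close>. The ranks of the three idempotents
  are their traces, hence add up to \<open>n\<close>.

  If a dual matrix \<open>A + \<epsilon> A\<^sub>0\<close> has an inner inverse, then \<open>K A\<^sub>0 L = O\<close> whenever \<open>K A = O\<close> and
  \<open>A L = O\<close>. Applied to \<open>E\<close>, \<open>F\<close> and \<open>F - E\<close> this forces all the zero and coinciding infinitesimal blocks.
  Conversely this vanishing yields a dual full rank factorization \<open>A + \<epsilon> A\<^sub>0 = M N\<close> and thereby the
  Moore-Penrose inverse \<open>N\<^sup>T (N N\<^sup>T)\<^sup>-\<^sup>1 (M\<^sup>T M)\<^sup>-\<^sup>1 M\<^sup>T\<close>.\<close>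

section \<open>Rank factorizations of real matrices\<close>

text \<open>Stating the side conditions as dimension equations leaves no intermediate size to be
  guessed, so the simplifier can discharge them when this law and its companions below serve as
  rewrite rules.\<close>

lemma mat_mult_assoc_dim:
  "dim_col A = dim_row B \<Longrightarrow> dim_col B = dim_row C \<Longrightarrow> A * B * C = A * (B * (C :: 'a :: semiring_0 mat))"
  by (rule assoc_mult_mat) auto

lemma mat_minus_mult_distrib_dim:
  "dim_row B = dim_row A \<Longrightarrow> dim_col B = dim_col A \<Longrightarrow> dim_col A = dim_row C \<Longrightarrow>
    (A - B) * C = A * C - B * (C :: 'a :: ring mat)"
  by (rule minus_mult_distrib_mat) auto

lemma mat_mult_minus_distrib_dim:
  "dim_row C = dim_row B \<Longrightarrow> dim_col C = dim_col B \<Longrightarrow> dim_col A = dim_row B \<Longrightarrow>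
    A * (B - C) = A * B - A * (C :: 'a :: ring mat)"
  by (rule mult_minus_distrib_mat) auto

lemma mat_transpose_mult_dim:
  "dim_col A = dim_row B \<Longrightarrow> transpose_mat (A * B) = transpose_mat B * transpose_mat (A :: 'a :: comm_semiring_0 mat)"
  by (rule transpose_mult) auto

lemmas mat_distrib_dim =
  mat_mult_assoc_dim mat_minus_mult_distrib_dim mat_mult_minus_distrib_dim

lemma mat_factor_through:
  assumes A: "A \<in> carrier_mat n m" and B: "B \<in> carrier_mat n k"
    and cols: "\<And>j. j < k \<Longrightarrow> \<exists>w \<in> carrier_vec m. A *\<^sub>v w = col B j"
  shows "\<exists>S \<in> carrier_mat m k. A * S = B"
proof -
  obtain w where w: "\<And>j. j < k \<Longrightarrow> w j \<in> carrier_vec m \<and> A *\<^sub>v w j = col B j"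
    using cols by metis
  define S where "S = mat m k (\<lambda>(i, j). w j $ i)"
  have S: "S \<in> carrier_mat m k" by (simp add: S_def)
  have "col S j = w j" if "j < k" for j
    using w[OF that] that by (auto simp: S_def)
  hence "col (A * S) j = col B j" if "j < k" for j
    using col_mult2[OF A S that] w that by simp
  hence "A * S = B"
    using A B S by (intro mat_col_eqI) (simp_all del: col_mult2)
  with S show ?thesis by blast
qed

text \<open>If \<open>C^T C v = 0\<close> then \<open>|C v|^2 = v^T C^T C v = 0\<close>, so
  \<open>C v = 0\<close> and injectivity gives \<open>v = 0\<close>. This rests on a sum of real
  squares vanishing only termwise; over the dual numbers the square of eps is zero, so dual Gram
  matrices are reached through their real parts.\<close>

lemma gram_inverse:
  fixes C :: "real mat"
  assumes C: "C \<in> carrier_mat n r"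
    and inj: "\<And>v. v \<in> carrier_vec r \<Longrightarrow> C *\<^sub>v v = 0\<^sub>v n \<Longrightarrow> v = 0\<^sub>v r"
  obtains Z where "Z \<in> carrier_mat r r"
    "Z * (transpose_mat C * C) = 1\<^sub>m r" "transpose_mat C * C * Z = 1\<^sub>m r"
proof -
  let ?G = "transpose_mat C * C"
  have G: "?G \<in> carrier_mat r r" using C by auto
  have "det ?G \<noteq> 0"
  proof
    assume "det ?G = 0"
    then obtain v where v: "v \<in> carrier_vec r" "v \<noteq> 0\<^sub>v r" "?G *\<^sub>v v = 0\<^sub>v r"
      using det_0_iff_vec_prod_zero[OF G] by blast
    have Cv: "C *\<^sub>v v \<in> carrier_vec n" using C v by auto
    have "transpose_mat C *\<^sub>v (C *\<^sub>v v) = 0\<^sub>v r"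
      using assoc_mult_mat_vec[of "transpose_mat C" r n C r v] v C by auto
    hence "v \<bullet> (transpose_mat C *\<^sub>v (C *\<^sub>v v)) = 0" using v by simp
    also have "v \<bullet> (transpose_mat C *\<^sub>v (C *\<^sub>v v)) = (C *\<^sub>v v) \<bullet> (C *\<^sub>v v)"
      using transpose_vec_mult_scalar[OF C v(1) Cv] comm_scalar_prod[OF v(1)] C Cv
      by (metis mult_mat_vec_carrier transpose_carrier_mat)
    finally have "(\<Sum>i<n. (C *\<^sub>v v) $ i * (C *\<^sub>v v) $ i) = 0"
      using C by (simp add: scalar_prod_def lessThan_atLeast0)
    hence "\<forall>i<n. (C *\<^sub>v v) $ i = 0"
      by (subst (asm) sum_nonneg_eq_0_iff) auto
    hence "C *\<^sub>v v = 0\<^sub>v n" using C by (intro eq_vecI) auto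
    with inj v show False by blast
  qed
  from det_non_zero_imp_unit[OF G this, of "()"] show ?thesis
    using that by (auto simp: Units_def ring_mat_def)
qed

text \<open>The columns of \<open>C\<close> form a maximal independent set of columns of \<open>A\<close>.\<close>

lemma rank_factorization:
  fixes A :: "real mat"
  assumes A: "A \<in> carrier_mat n m"
  defines "r \<equiv> vec_space.rank n A"
  obtains C R S L where "C \<in> carrier_mat n r" "R \<in> carrier_mat r m" "S \<in> carrier_mat m r"
    "L \<in> carrier_mat r n" "C * R = A" "A * S = C" "L * C = 1\<^sub>m r"
proof -
  interpret vec_space "TYPE(real)" n .
  have cA: "set (cols A) \<subseteq> carrier_vec n" using cols_dim A by blast
  obtain U where U: "finite U" "maximal U (\<lambda>T. T \<subseteq> set (cols A) \<and> lin_indpt T)"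
    using maximal_exists_superset[of "set (cols A)" "\<lambda>T. T \<subseteq> set (cols A) \<and> lin_indpt T" "{}"]
    by (auto simp: finite_lin_indpt2)
  have UA: "U \<subseteq> set (cols A)" and Ui: "lin_indpt U"
    using U(2) by (auto simp: maximal_def)
  have Un: "U \<subseteq> carrier_vec n" using UA cA by blast
  obtain us where us: "set us = U" "distinct us" using U(1) finite_distinct_list by blast
  have r: "length us = r"
    using rank_card_indpt[OF A U(2)] us distinct_card by (metis r_def)
  define C where "C = mat_of_cols n us"
  have C: "C \<in> carrier_mat n r" by (simp add: C_def r carrier_matI)
  have cC: "cols C = us" using us Un by (simp add: C_def)
  have "v = 0\<^sub>v r" if "v \<in> carrier_vec r" "C *\<^sub>v v = 0\<^sub>v n" for v
    using lin_depI[OF C that(1) _ that(2)] Ui us cC by metis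
  from gram_inverse[OF C this] obtain Z where Z: "Z \<in> carrier_mat r r"
    "Z * (transpose_mat C * C) = 1\<^sub>m r" by metis
  \<comment> \<open>Otherwise \<open>insert a U\<close> would be a larger independent set of
    columns, against maximality.\<close>
  have span: "a \<in> span U" if "a \<in> set (cols A)" for a
  proof (rule ccontr)
    assume a: "a \<notin> span U"
    hence "a \<notin> U" using Un span_mem by blast
    moreover have "lin_indpt (insert a U)"
      using lin_dep_iff_in_span[OF Un Ui _ \<open>a \<notin> U\<close>] a that cA by auto
    ultimately show False
      using U(2) that UA unfolding maximal_def by (metis insert_subset insertI1 subset_insertI)
  qed
  have "\<exists>w \<in> carrier_vec r. C *\<^sub>v w = col A j" if "j < m" for j
  proof -
    have "col A j \<in> span U" using span that A by (metis carrier_matD(2) cols_length cols_nth nth_mem)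
    then obtain a where "col A j = lincomb a U" using finite_in_span[OF U(1) Un] by metis
    hence "C *\<^sub>v vec r (\<lambda>i. a (col C i)) = col A j"
      using mat_mult_eq_lincomb[OF C, of a] cC us by metis
    thus ?thesis by (metis vec_carrier)
  qed
  from mat_factor_through[OF C A this] obtain R where R: "R \<in> carrier_mat r m" "C * R = A" by blast
  \<comment> \<open>Each column of \<open>C\<close> is some column of \<open>A\<close>, hence the
    image of a unit vector under \<open>A\<close>.\<close>
  have "\<exists>w \<in> carrier_vec m. A *\<^sub>v w = col C j" if "j < r" for j
  proof -
    have "col C j \<in> set (cols A)" using cC UA us that C
      by (metis carrier_matD(2) cols_length cols_nth nth_mem subsetD)
    then obtain i where "i < m" "col C j = col A i" using A
      by (metis carrier_matD(2) cols_length cols_nth in_set_conv_nth)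
    moreover from this A have "A *\<^sub>v unit_vec m i = col A i" by (intro eq_vecI) auto
    ultimately show ?thesis by (metis unit_vec_carrier)
  qed
  from mat_factor_through[OF A C this] obtain S where S: "S \<in> carrier_mat m r" "A * S = C" by blast
  \<comment> \<open>The left inverse of \<open>C\<close> is \<open>(C^T C)^-1 C^T\<close>.\<close>
  have "Z * transpose_mat C * C = 1\<^sub>m r" using Z C by (simp add: mat_mult_assoc_dim)
  moreover have "Z * transpose_mat C \<in> carrier_mat r n" using Z C by auto
  ultimately show ?thesis using that[OF C R(1) S(1) _ R(2) S(2)] by blast
qed

text \<open>Write \<open>A = C R\<close> with \<open>A S = C\<close> and \<open>L C = 1\<close>.
  Then \<open>A X = C (R X)\<close>, and \<open>C (R X C) = A X A S = A S = C\<close>, where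
  \<open>L\<close> cancels the leading \<open>C\<close>. Thus the idempotent \<open>A X\<close>
  splits through a space whose dimension is the rank of \<open>A\<close>.\<close>

lemma inner_inverse_factorization:
  fixes A :: "real mat"
  assumes A: "A \<in> carrier_mat n n" and X: "X \<in> carrier_mat n n" and AXA: "A * X * A = A"
  defines "r \<equiv> vec_space.rank n A"
  obtains C R where "C \<in> carrier_mat n r" "R \<in> carrier_mat r n" "A * X = C * R" "R * C = 1\<^sub>m r"
proof -
  obtain C R S L where CRSL: "C \<in> carrier_mat n r" "R \<in> carrier_mat r n" "S \<in> carrier_mat n r"
    "L \<in> carrier_mat r n" "C * R = A" "A * S = C" "L * C = 1\<^sub>m r"
    using rank_factorization[OF A] unfolding r_def by blast
  have "C * (R * X) = A * X" using CRSL X by (simp add: mat_mult_assoc_dim flip: CRSL(5))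
  moreover have "R * X * C = 1\<^sub>m r"
  proof -
    have "C * (R * X * C) = (C * R) * X * C" using CRSL(1,2) X by (simp add: mat_mult_assoc_dim)
    also have "\<dots> = A * X * (A * S)" by (simp add: CRSL(5,6))
    also have "\<dots> = A * X * A * S" using CRSL(3) A X by (simp add: mat_mult_assoc_dim)
    also have "\<dots> = C" by (simp add: AXA CRSL)
    finally have "L * (C * (R * X * C)) = L * C" by simp
    moreover have "L * (C * (R * X * C)) = (L * C) * (R * X * C)"
      using CRSL(1-4) X by (simp add: mat_mult_assoc_dim)
    ultimately show ?thesis using CRSL(1-4) X by (simp add: CRSL(7))
  qed
  ultimately show ?thesis using that[OF CRSL(1), of "R * X"] CRSL X by simp
qed

section \<open>Ranks as traces of idempotents\<close>

definition trace_mat :: "'a :: comm_monoid_add mat \<Rightarrow> 'a" where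
  "trace_mat A = (\<Sum>i < dim_row A. A $$ (i, i))"

lemma trace_mat_mult_commute:
  assumes "A \<in> carrier_mat n m" "B \<in> carrier_mat m n"
  shows "trace_mat (A * B) = trace_mat (B * (A :: 'a :: comm_semiring_0 mat))"
proof -
  have "trace_mat (A * B) = (\<Sum>i<n. \<Sum>j<m. A $$ (i, j) * B $$ (j, i))"
    using assms by (simp add: trace_mat_def scalar_prod_def lessThan_atLeast0)
  also have "\<dots> = (\<Sum>j<m. \<Sum>i<n. A $$ (i, j) * B $$ (j, i))" by (rule sum.swap)
  also have "\<dots> = trace_mat (B * A)"
    using assms by (simp add: trace_mat_def scalar_prod_def lessThan_atLeast0 mult.commute)
  finally show ?thesis .
qed

lemma trace_mat_minus:
  "A \<in> carrier_mat n n \<Longrightarrow> B \<in> carrier_mat n n \<Longrightarrow>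
    trace_mat (A - B) = trace_mat A - trace_mat (B :: 'a :: ab_group_add mat)"
  by (simp add: trace_mat_def sum_subtractf)

lemma trace_mat_one: "trace_mat (1\<^sub>m n :: 'a :: semiring_1 mat) = of_nat n"
  by (simp add: trace_mat_def)

text \<open>With \<open>A X = C R\<close> and \<open>R C\<close> an identity matrix of size the
  rank, cyclicity of the trace gives the claim. It turns additivity of ranks into additivity of
  traces.\<close>

lemma rank_eq_trace:
  fixes A :: "real mat"
  assumes "A \<in> carrier_mat n n" "X \<in> carrier_mat n n" "A * X * A = A"
  shows "real (vec_space.rank n A) = trace_mat (A * X)"
proof -
  obtain C R where "C \<in> carrier_mat n (vec_space.rank n A)" "R \<in> carrier_mat (vec_space.rank n A) n"
    "A * X = C * R" "R * C = 1\<^sub>m (vec_space.rank n A)"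
    using inner_inverse_factorization[OF assms] by blast
  thus ?thesis using trace_mat_mult_commute trace_mat_one by metis
qed

text \<open>Commutation makes \<open>X * X\<close> an inner inverse of \<open>A * A\<close> with
  \<open>A * A * (X * X) = A * X\<close>, so both ranks are the trace of the same
  idempotent.\<close>

lemma rank_square_eq:
  fixes A :: "real mat"
  assumes A: "A \<in> carrier_mat n n" and X: "X \<in> carrier_mat n n"
    and AXA: "A * X * A = A" and comm: "A * X = X * A"
  shows "vec_space.rank n (A * A) = vec_space.rank n A"
proof -
  note d = carrier_matD[OF A] carrier_matD[OF X]
  have XAA: "X * (A * A) = A"
    using AXA d by (simp add: comm mat_mult_assoc_dim)
  have *: "A * A * (X * X) = A * X"
  proof -
    have "A * A * (X * X) = A * (A * X) * X" using d by (simp add: mat_mult_assoc_dim)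
    also have "\<dots> = A * X * A * X" unfolding comm using d by (simp add: mat_mult_assoc_dim flip: comm)
    finally show ?thesis by (simp add: AXA)
  qed
  have "A * A * (X * X) * (A * A) = A * (X * (A * A))" using d by (simp add: * mat_mult_assoc_dim)
  hence "A * A * (X * X) * (A * A) = A * A" by (simp add: XAA)
  from rank_eq_trace[OF mult_carrier_mat[OF A A] mult_carrier_mat[OF X X] this] rank_eq_trace[OF A X AXA] show ?thesis
    by (simp add: *)
qed

section \<open>Dual matrices with a Moore-Penrose inverse\<close>

lemma std_sum: "std (sum f A) = (\<Sum>x\<in>A. std (f x))"
  and inft_sum: "inft (sum f A) = (\<Sum>x\<in>A. inft (f x))"
  by (induction A rule: infinite_finite_induct) (auto simp: dual_num_defs)

lemma dim_dual_mat [simp]: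
  "dim_row (dual_mat A A0) = dim_row A0" "dim_col (dual_mat A A0) = dim_col A0"
  by (simp_all add: dual_mat_def)

lemma inft_dual_mat:
  assumes "A \<in> carrier_mat m n" "A0 \<in> carrier_mat m n"
  shows "map_mat inft (dual_mat A A0) = A0"
  by (rule eq_matI) (use assms in \<open>auto simp: dual_mat_index\<close>)

lemma dual_mat_eqD:
  assumes "dual_mat A A0 = dual_mat B B0" "A \<in> carrier_mat m n" "A0 \<in> carrier_mat m n"
    "B \<in> carrier_mat m n" "B0 \<in> carrier_mat m n"
  shows "A = B" "A0 = B0"
  using assms std_part_dual_mat inft_dual_mat by metis+

lemma dual_mat_cases:
  assumes "X \<in> carrier_mat m n"
  obtains Y Y0 where "Y \<in> carrier_mat m n" "Y0 \<in> carrier_mat m n" "X = dual_mat Y Y0"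
  using dual_mat_decomp[of X] assms that[of "std_part X" "map_mat inft X"]
  by (auto simp: std_part_def)

lemma dual_mat_mult:
  assumes "A \<in> carrier_mat m n" "A0 \<in> carrier_mat m n" "B \<in> carrier_mat n k" "B0 \<in> carrier_mat n k"
  shows "dual_mat A A0 * dual_mat B B0 = dual_mat (A * B) (A * B0 + A0 * B)"
  by (rule eq_matI)
    (use assms in \<open>auto simp: dual_mat_index scalar_prod_def dual_num.expand std_sum inft_sum
      times_dual_num_def sum.distrib\<close>)

lemma dual_mat_minus:
  assumes "A \<in> carrier_mat m n" "A0 \<in> carrier_mat m n" "B \<in> carrier_mat m n" "B0 \<in> carrier_mat m n"
  shows "dual_mat A A0 - dual_mat B B0 = dual_mat (A - B) (A0 - B0)"
  by (rule eq_matI) (use assms in \<open>auto simp: dual_mat_index[of _ "A - B"] dual_mat_index minus_dual_num_def minus_carrier_mat\<close>)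

lemma dual_mat_transpose:
  assumes "A \<in> carrier_mat m n" "A0 \<in> carrier_mat m n"
  shows "transpose_mat (dual_mat A A0) = dual_mat (transpose_mat A) (transpose_mat A0)"
  by (rule eq_matI) (use assms in \<open>auto simp: dual_mat_index\<close>)

lemma dual_mat_one: "dual_mat (1\<^sub>m n) (0\<^sub>m n n) = 1\<^sub>m n"
  by (rule eq_matI) (auto simp: dual_mat_index one_dual_num_def zero_dual_num_def)

text \<open>The inverse of \<open>G + eps G0\<close> is \<open>Z - eps Z G0 Z\<close>: the Neumann
  series stops after the linear term because eps squares to zero.\<close>

lemma dual_inverse:
  fixes G G0 Z :: "real mat"
  assumes G: "G \<in> carrier_mat n n" "G0 \<in> carrier_mat n n" and Z: "Z \<in> carrier_mat n n"
    and inv: "Z * G = 1\<^sub>m n" "G * Z = 1\<^sub>m n"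
  obtains W where "W \<in> carrier_mat n n" "W * dual_mat G G0 = 1\<^sub>m n" "dual_mat G G0 * W = 1\<^sub>m n"
proof
  let ?Y = "0\<^sub>m n n - Z * G0 * Z"
  have Y: "?Y \<in> carrier_mat n n" using G Z by auto
  have d: "Z * G0 + ?Y * G = 0\<^sub>m n n"
    using G Z by (simp add: mat_distrib_dim inv) (auto intro!: eq_matI)
  have "G * (Z * G0 * Z) = G * Z * (G0 * Z)"
    using G Z by (simp add: mat_distrib_dim)
  hence e: "G * ?Y + G0 * Z = 0\<^sub>m n n"
    using G Z by (simp add: mat_mult_minus_distrib_dim inv) (auto intro!: eq_matI)
  show "dual_mat Z ?Y \<in> carrier_mat n n" using Y by (rule dual_mat_carrier)
  show "dual_mat Z ?Y * dual_mat G G0 = 1\<^sub>m n"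
    by (simp add: dual_mat_mult[OF Z Y G] inv d dual_mat_one)
  show "dual_mat G G0 * dual_mat Z ?Y = 1\<^sub>m n"
    by (simp add: dual_mat_mult[OF G Z Y] inv e dual_mat_one)
qed

text \<open>The left inverse \<open>L\<close> makes \<open>C\<close> injective, so the real part
  \<open>C^T C\<close> of the dual Gram matrix is invertible, and then so is the Gram matrix itself.
  Symmetry of \<open>Z\<close> is recorded for the symmetry conditions on the Moore-Penrose
  inverse.\<close>

lemma dual_gram_inverse:
  assumes C: "C \<in> carrier_mat n q" "C0 \<in> carrier_mat n q"
    and L: "L \<in> carrier_mat q n" "L * C = 1\<^sub>m q"
  defines "M \<equiv> dual_mat C C0"
  obtains Z where "Z \<in> carrier_mat q q" "transpose_mat Z = Z" "Z * (transpose_mat M * M) = 1\<^sub>m q"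
    "transpose_mat M * M * Z = 1\<^sub>m q"
proof -
  have "v = 0\<^sub>v q" if v: "v \<in> carrier_vec q" "C *\<^sub>v v = 0\<^sub>v n" for v
  proof -
    have "v = L * C *\<^sub>v v" using L v by simp
    also have "\<dots> = 0\<^sub>v q" using L C v by (subst assoc_mult_mat_vec[of _ _ n _ q]) auto
    finally show ?thesis .
  qed
  from gram_inverse[OF C(1) this] obtain Y where Y: "Y \<in> carrier_mat q q"
    "Y * (transpose_mat C * C) = 1\<^sub>m q" "transpose_mat C * C * Y = 1\<^sub>m q" by metis
  let ?G = "transpose_mat M * M"
  have G: "?G = dual_mat (transpose_mat C * C) (transpose_mat C * C0 + transpose_mat C0 * C)"
    unfolding M_def dual_mat_transpose[OF C] by (rule dual_mat_mult[of _ q n _ _ q]) (use C in auto)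
  have "transpose_mat C * C \<in> carrier_mat q q"
    "transpose_mat C * C0 + transpose_mat C0 * C \<in> carrier_mat q q" using C by auto
  from dual_inverse[OF this Y, folded G]
  obtain Z where Z: "Z \<in> carrier_mat q q" "Z * ?G = 1\<^sub>m q" "?G * Z = 1\<^sub>m q" .
  have dM: "dim_row M = n" "dim_col M = q" using C by (auto simp: M_def)
  \<comment> \<open>The Gram matrix \<open>?G\<close> is symmetric, so \<open>Z^T ?G\<close> is the
    transpose of \<open>?G * Z\<close>, which is the identity.\<close>
  have "transpose_mat Z = transpose_mat Z * (?G * Z)" using Z by simp
  also have "\<dots> = transpose_mat (?G * Z) * Z"
    using Z(1) dM by (simp add: mat_transpose_mult_dim mat_mult_assoc_dim)
  also have "\<dots> = Z" using Z by simp
  finally show ?thesis using that Z by blast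
qed

text \<open>The classical full rank formula, valid over the dual numbers once both Gram matrices are
  inverted. The two products collapse to \<open>M Z M^T\<close> and \<open>N^T W N\<close>, which
  are symmetric because \<open>Z\<close> and \<open>W\<close> are.\<close>

lemma DMPGI_of_factorization:
  assumes M: "M \<in> carrier_mat m q" and N: "N \<in> carrier_mat q n"
    and Z: "Z \<in> carrier_mat q q" "transpose_mat Z = Z" "Z * (transpose_mat M * M) = 1\<^sub>m q"
    and W: "W \<in> carrier_mat q q" "transpose_mat W = W" "N * transpose_mat N * W = 1\<^sub>m q"
  shows "is_DMPGI (M * N) (transpose_mat N * W * Z * transpose_mat M)"
proof -
  let ?A = "M * N" and ?X = "transpose_mat N * W * Z * transpose_mat M"
  note d = carrier_matD[OF M] carrier_matD[OF N] carrier_matD[OF Z(1)] carrier_matD[OF W(1)]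
  have "?A * ?X = M * (N * transpose_mat N * W) * Z * transpose_mat M"
    using d by (simp add: mat_mult_assoc_dim)
  hence AX: "?A * ?X = M * Z * transpose_mat M" using M by (simp add: W)
  have "?X * ?A = transpose_mat N * W * (Z * (transpose_mat M * M)) * N"
    using d by (simp add: mat_mult_assoc_dim)
  hence XA: "?X * ?A = transpose_mat N * W * N" using d by (simp add: Z)
  have "?A * ?X * ?A = M * (Z * (transpose_mat M * M)) * N"
    unfolding AX using d by (simp add: mat_mult_assoc_dim)
  hence 1: "?A * ?X * ?A = ?A" using M by (simp add: Z)
  have "?X * ?A * ?X = transpose_mat N * W * (N * transpose_mat N * W) * Z * transpose_mat M"
    unfolding XA using d by (simp add: mat_mult_assoc_dim)
  hence 2: "?X * ?A * ?X = ?X" using d by (simp add: W)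
  show ?thesis
    unfolding is_DMPGI_def 1 2 unfolding AX XA
    using d by (intro conjI carrier_matI) (simp_all add: mat_transpose_mult_dim mat_mult_assoc_dim Z(2) W(2))
qed

text \<open>The infinitesimal part of the inner inverse equation writes \<open>A0\<close> as a sum
  of a term beginning with \<open>A\<close> and a term ending with \<open>A\<close>. Multiplication
  by \<open>K\<close> on the left kills the first, by \<open>L\<close> on the right the
  second.\<close>

lemma inner_inverse_inft_zero:
  assumes A: "A \<in> carrier_mat n n" "A0 \<in> carrier_mat n n" and X: "X \<in> carrier_mat n n"
    and inner: "dual_mat A A0 * X * dual_mat A A0 = dual_mat A A0"
    and K: "K \<in> carrier_mat k n" "K * A = 0\<^sub>m k n" and L: "L \<in> carrier_mat n l" "A * L = 0\<^sub>m n l"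
  shows "K * A0 * L = 0\<^sub>m k l"
proof -
  obtain Y Y0 where Y: "Y \<in> carrier_mat n n" "Y0 \<in> carrier_mat n n" "X = dual_mat Y Y0"
    using dual_mat_cases[OF X] .
  note d = carrier_matD[OF A(1)] carrier_matD[OF A(2)] carrier_matD[OF Y(1)] carrier_matD[OF Y(2)]
    carrier_matD[OF K(1)] carrier_matD[OF L(1)]
  have eq: "dual_mat A A0 * X * dual_mat A A0 =
      dual_mat (A * Y * A) (A * Y * A0 + (A * Y0 + A0 * Y) * A)"
    unfolding Y(3) dual_mat_mult[OF A Y(1,2)]
    by (rule dual_mat_mult[of _ n n _ _ n]) (use A Y(1,2) in auto)
  define V where "V = A * Y0 + A0 * Y"
  have V: "V \<in> carrier_mat n n" using A Y(1,2) by (auto simp: V_def)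
  from eq[unfolded inner] have "A0 = A * Y * A0 + (A * Y0 + A0 * Y) * A"
    by (rule dual_mat_eqD(2)) (use A Y(1,2) in auto)
  from arg_cong[OF this, of "\<lambda>M. K * M"]
  have "K * A0 = K * (A * Y * A0 + V * A)" by (simp only: V_def)
  also have "\<dots> = K * (A * Y * A0) + K * (V * A)"
    by (rule mult_add_distrib_mat[of _ k n _ n]) (use A Y(1,2) V K in auto)
  finally have "K * A0 = K * (A * Y * A0) + K * (V * A)" .
  hence "K * A0 * L = K * (A * Y * A0) * L + K * (V * A) * L"
    by (simp only:) (rule add_mult_distrib_mat[of _ k n _ _ l], use A Y(1,2) V K L in auto)
  moreover have "K * (A * Y * A0) * L = (K * A) * (Y * A0 * L)"
    using d by (simp add: mat_mult_assoc_dim)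
  moreover have "K * (V * A) * L = K * V * (A * L)"
    using d V by (simp add: mat_mult_assoc_dim)
  moreover have "Y * A0 * L \<in> carrier_mat n l" "K * V \<in> carrier_mat k n"
    using A Y(1,2) V K L by auto
  ultimately show ?thesis by (simp only: K(2) L(2) left_mult_zero_mat right_mult_zero_mat left_add_zero_mat zero_carrier_mat)
qed

lemma mat_minus_eq_zeroD:
  fixes A B :: "'a :: ab_group_add mat"
  assumes "A \<in> carrier_mat m n" "B \<in> carrier_mat m n" "A - B = 0\<^sub>m m n"
  shows "A = B"
proof (rule eq_matI)
  fix i j assume "i < dim_row B" "j < dim_col B"
  thus "A $$ (i, j) = B $$ (i, j)"
    using assms(1,2) arg_cong[OF assms(3), of "\<lambda>M. M $$ (i, j)"] by simp
qed (use assms in auto)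

text \<open>A converse to \<open>inner_inverse_inft_zero\<close>: the vanishing is required only for
  the complementary projectors \<open>K = I - A X\<close> and \<open>L = I - X A\<close>, and it
  allows a full rank factorization of \<open>A\<close> to be lifted to
  \<open>dual_mat A A0\<close>.\<close>

lemma DMPGI_exists:
  assumes A: "A \<in> carrier_mat n n" "A0 \<in> carrier_mat n n" and X: "X \<in> carrier_mat n n"
    and AXA: "A * X * A = A"
    and zero: "(1\<^sub>m n - A * X) * A0 * (1\<^sub>m n - X * A) = 0\<^sub>m n n"
  shows "\<exists>Y. is_DMPGI (dual_mat A A0) Y"
proof -
  define q where "q = vec_space.rank n A"
  obtain C S where C: "C \<in> carrier_mat n q" and S: "S \<in> carrier_mat q n"
    and AX: "A * X = C * S" and SC: "S * C = 1\<^sub>m q"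
    using inner_inverse_factorization[OF A(1) X AXA] unfolding q_def .
  let ?K = "1\<^sub>m n - A * X"
  note d = carrier_matD[OF A(1)] carrier_matD[OF A(2)] carrier_matD[OF X]
    carrier_matD[OF C] carrier_matD[OF S]
  \<comment> \<open>The infinitesimal part is split as \<open>A0 = A X A0 + (I - A X) A0\<close>:
    \<open>C * N0\<close> yields the first summand and \<open>C0 * N\<close> the second.\<close>
  define C0 where "C0 = ?K * A0 * X * C"
  define N where "N = S * A"
  define N0 where "N0 = S * A0"
  have C0: "C0 \<in> carrier_mat n q" and N: "N \<in> carrier_mat q n" and N0: "N0 \<in> carrier_mat q n"
    using d by (auto simp: C0_def N_def N0_def)
  have CN: "C * N = A"
  proof -
    have "C * N = A * X * A" using d by (simp add: N_def AX mat_mult_assoc_dim)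
    thus ?thesis by (simp add: AXA)
  qed
  have "C * N0 + C0 * N = A * X * A0 + ?K * A0 * (X * A)"
  proof -
    have "C0 * N = ?K * A0 * X * (C * N)" using d N by (simp add: C0_def mat_mult_assoc_dim)
    moreover have "C * N0 = A * X * A0" using d by (simp add: N0_def AX mat_mult_assoc_dim)
    ultimately show ?thesis using d by (simp add: CN mat_mult_assoc_dim)
  qed
  \<comment> \<open>This is exactly the vanishing hypothesis, multiplied out.\<close>
  also have "?K * A0 * (X * A) = ?K * A0"
  proof -
    have KA0: "?K * A0 \<in> carrier_mat n n" using A X by auto
    have "?K * A0 * (1\<^sub>m n - X * A) = ?K * A0 * 1\<^sub>m n - ?K * A0 * (X * A)"
      by (rule mult_minus_distrib_mat[OF KA0]) (use A X in auto)
    hence "?K * A0 - ?K * A0 * (X * A) = 0\<^sub>m n n"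
      unfolding zero right_mult_one_mat[OF KA0] by (rule sym)
    with KA0 KA0 have "?K * A0 = ?K * A0 * (X * A)"
      by (rule mat_minus_eq_zeroD[OF _ mult_carrier_mat[OF _ mult_carrier_mat[OF X A(1)]]])
    thus ?thesis by (rule sym)
  qed
  also have "A * X * A0 + ?K * A0 = (A * X + ?K) * A0"
    using A X by (intro add_mult_distrib_mat[symmetric, of _ n n]) auto
  also have "A * X + ?K = 1\<^sub>m n"
    using d by (intro eq_matI) (simp_all del: index_mult_mat(1))
  also have "1\<^sub>m n * A0 = A0" using A by simp
  finally have CN0: "C * N0 + C0 * N = A0" .
  have fact: "dual_mat A A0 = dual_mat C C0 * dual_mat N N0"
    by (simp add: dual_mat_mult[OF C C0 N N0] CN CN0)
  obtain Z where Z: "Z \<in> carrier_mat q q" "transpose_mat Z = Z"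
    "Z * (transpose_mat (dual_mat C C0) * dual_mat C C0) = 1\<^sub>m q"
    using dual_gram_inverse[OF C C0 S SC] .
  \<comment> \<open>\<open>X * C\<close> is a right inverse of \<open>N\<close>, so
    \<open>N^T\<close> has a left inverse and \<open>dual_gram_inverse\<close> applies to
    it.\<close>
  have "N * (X * C) = S * (A * X) * C" using d by (simp add: N_def mat_mult_assoc_dim)
  also have "\<dots> = (S * C) * (S * C)" unfolding AX using d by (simp add: mat_mult_assoc_dim)
  finally have "N * (X * C) = 1\<^sub>m q" by (simp add: SC)
  hence "transpose_mat (X * C) * transpose_mat N = 1\<^sub>m q"
    using d N by (subst mat_transpose_mult_dim[symmetric]) auto
  moreover have "transpose_mat N \<in> carrier_mat n q" "transpose_mat N0 \<in> carrier_mat n q"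
    "transpose_mat (X * C) \<in> carrier_mat q n"
    using N N0 C X by auto
  ultimately obtain W where "W \<in> carrier_mat q q" "transpose_mat W = W"
    "transpose_mat (dual_mat (transpose_mat N) (transpose_mat N0)) *
      dual_mat (transpose_mat N) (transpose_mat N0) * W = 1\<^sub>m q"
    using dual_gram_inverse by metis
  hence W: "W \<in> carrier_mat q q" "transpose_mat W = W"
    "dual_mat N N0 * transpose_mat (dual_mat N N0) * W = 1\<^sub>m q"
    by (simp_all flip: dual_mat_transpose[OF N N0])
  show ?thesis
    unfolding fact using DMPGI_of_factorization[OF _ _ Z W] C0 N0 dual_mat_carrier by blast
qed

section \<open>Block matrices\<close>

text \<open>Row blocks are stacked with the same operation, by transposing the concatenation of
  their transposes.\<close>

definition hcat3 :: "'a mat \<Rightarrow> 'a mat \<Rightarrow> 'a mat \<Rightarrow> 'a mat" where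
  "hcat3 A B C = mat (dim_row A) (dim_col A + dim_col B + dim_col C) (\<lambda>(i, j).
     if j < dim_col A then A $$ (i, j)
     else if j < dim_col A + dim_col B then B $$ (i, j - dim_col A)
     else C $$ (i, j - (dim_col A + dim_col B)))"

lemma hcat3_carrier:
  "A \<in> carrier_mat n p \<Longrightarrow> B \<in> carrier_mat n q \<Longrightarrow> C \<in> carrier_mat n r \<Longrightarrow>
    hcat3 A B C \<in> carrier_mat n (p + q + r)"
  by (auto simp: hcat3_def)

lemma col_hcat3:
  assumes "A \<in> carrier_mat n p" "B \<in> carrier_mat n q" "C \<in> carrier_mat n r" "j < p + q + r"
  shows "col (hcat3 A B C) j =
    (if j < p then col A j else if j < p + q then col B (j - p) else col C (j - (p + q)))"
  by (rule eq_vecI) (use assms in \<open>auto simp: hcat3_def\<close>)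

text \<open>An entry of the product is a row of the left factor applied to \<open>M\<close> times a
  column of the right factor, and each such row and column belongs to a single block. This reads off
  the blocks of \<open>M\<close> in a new basis.\<close>

lemma conj_hcat3_eq_block3:
  fixes M :: "real mat"
  assumes M: "M \<in> carrier_mat n n"
    and C: "C1 \<in> carrier_mat n p" "C2 \<in> carrier_mat n q" "C3 \<in> carrier_mat n r"
    and R: "R1 \<in> carrier_mat p n" "R2 \<in> carrier_mat q n" "R3 \<in> carrier_mat r n"
  shows "transpose_mat (hcat3 (transpose_mat R1) (transpose_mat R2) (transpose_mat R3)) * M * hcat3 C1 C2 C3 =
    block3_mat (R1 * M * C1) (R1 * M * C2) (R1 * M * C3)
      (R2 * M * C1) (R2 * M * C2) (R2 * M * C3)
      (R3 * M * C1) (R3 * M * C2) (R3 * M * C3)" (is "transpose_mat ?Q * M * ?P = ?B")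
proof (rule eq_matI)
  have P: "?P \<in> carrier_mat n (p + q + r)" by (rule hcat3_carrier[OF C])
  have Q: "?Q \<in> carrier_mat n (p + q + r)" by (rule hcat3_carrier) (use R in auto)
  have B: "?B \<in> carrier_mat (p + q + r) (p + q + r)"
    by (rule block3_mat_carrier) (use R C in auto)
  show "dim_row (transpose_mat ?Q * M * ?P) = dim_row ?B" "dim_col (transpose_mat ?Q * M * ?P) = dim_col ?B"
    using P Q B by auto
  fix i j assume "i < dim_row ?B" "j < dim_col ?B"
  hence ij: "i < p + q + r" "j < p + q + r" using B by auto
  have entry: "(K * M * L) $$ (a, b) = row K a \<bullet> (M *\<^sub>v col L b)"
    if "K \<in> carrier_mat k n" "L \<in> carrier_mat n l" "a < k" "b < l" for K L :: "real mat" and a b k l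
  proof -
    have "(K * M * L) $$ (a, b) = (K * (M * L)) $$ (a, b)"
      using that M by (simp add: mat_mult_assoc_dim del: index_mult_mat(1))
    also have "\<dots> = row K a \<bullet> col (M * L) b" using that M by (intro index_mult_mat(1)) auto
    finally show ?thesis by (simp only: col_mult2[OF M that(2,4)])
  qed
  have "(transpose_mat ?Q * M * ?P) $$ (i, j) = col ?Q i \<bullet> (M *\<^sub>v col ?P j)"
    using entry[of "transpose_mat ?Q" "p + q + r" ?P "p + q + r" i j] P Q ij by auto
  also have "col ?Q i = (if i < p then row R1 i else if i < p + q then row R2 (i - p) else row R3 (i - (p + q)))"
    using R ij by (subst col_hcat3[of _ n p _ q _ r]) auto
  also have "col ?P j = (if j < p then col C1 j else if j < p + q then col C2 (j - p) else col C3 (j - (p + q)))"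
    using C ij by (intro col_hcat3)
  finally have 1: "(transpose_mat ?Q * M * ?P) $$ (i, j) =
      (if i < p then row R1 i else if i < p + q then row R2 (i - p) else row R3 (i - (p + q))) \<bullet>
      (M *\<^sub>v (if j < p then col C1 j else if j < p + q then col C2 (j - p) else col C3 (j - (p + q))))" .
  have 2: "?B $$ (i, j) = (if i < p then
       if j < p then (R1 * M * C1) $$ (i, j)
       else if j < p + q then (R1 * M * C2) $$ (i, j - p) else (R1 * M * C3) $$ (i, j - (p + q))
     else if i < p + q then
       if j < p then (R2 * M * C1) $$ (i - p, j)
       else if j < p + q then (R2 * M * C2) $$ (i - p, j - p) else (R2 * M * C3) $$ (i - p, j - (p + q))
     else
       if j < p then (R3 * M * C1) $$ (i - (p + q), j)
       else if j < p + q then (R3 * M * C2) $$ (i - (p + q), j - p)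
       else (R3 * M * C3) $$ (i - (p + q), j - (p + q)))"
    by (rule block3_mat_index) (use R C M ij in auto)
  have "i - p < q" if "\<not> i < p" "i < p + q" using that by linarith
  moreover have "i - (p + q) < r" if "\<not> i < p + q" using that ij by linarith
  moreover have "j - p < q" if "\<not> j < p" "j < p + q" using that by linarith
  moreover have "j - (p + q) < r" if "\<not> j < p + q" using that ij by linarith
  ultimately show "(transpose_mat ?Q * M * ?P) $$ (i, j) = ?B $$ (i, j)"
    unfolding 1 2
    by (simp add: entry[OF R(1) C(1)] entry[OF R(1) C(2)] entry[OF R(1) C(3)]
      entry[OF R(2) C(1)] entry[OF R(2) C(2)] entry[OF R(2) C(3)]
      entry[OF R(3) C(1)] entry[OF R(3) C(2)] entry[OF R(3) C(3)])
qed

section \<open>Products and differences of block matrices\<close>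

lemma sum_lessThan_add3:
  fixes f :: "nat \<Rightarrow> 'a :: comm_monoid_add"
  shows "(\<Sum>k<p + q + r. f k) = (\<Sum>k<p. f k) + (\<Sum>k<q. f (p + k)) + (\<Sum>k<r. f (p + q + k))"
proof -
  have "(\<Sum>k<a + b. g k) = (\<Sum>k<a. g k) + (\<Sum>k<b. g (a + k))" for a b and g :: "nat \<Rightarrow> 'a"
    by (induction b) (simp_all add: add.assoc)
  thus ?thesis by simp
qed

text \<open>Indices written as offset plus local index avoid truncated subtraction and match the
  summands produced by \<open>sum_lessThan_add3\<close>.\<close>

lemma block3_mat_entries:
  assumes A: "A1 \<in> carrier_mat p p" "A2 \<in> carrier_mat p q" "A3 \<in> carrier_mat p r"
      "A4 \<in> carrier_mat q p" "A5 \<in> carrier_mat q q" "A6 \<in> carrier_mat q r"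
      "A7 \<in> carrier_mat r p" "A8 \<in> carrier_mat r q" "A9 \<in> carrier_mat r r"
  defines "M \<equiv> block3_mat A1 A2 A3 A4 A5 A6 A7 A8 A9"
  shows "i < p \<Longrightarrow> j < p \<Longrightarrow> M $$ (i, j) = A1 $$ (i, j)"
    and "i < p \<Longrightarrow> j < q \<Longrightarrow> M $$ (i, p + j) = A2 $$ (i, j)"
    and "i < p \<Longrightarrow> j < r \<Longrightarrow> M $$ (i, p + q + j) = A3 $$ (i, j)"
    and "i < q \<Longrightarrow> j < p \<Longrightarrow> M $$ (p + i, j) = A4 $$ (i, j)"
    and "i < q \<Longrightarrow> j < q \<Longrightarrow> M $$ (p + i, p + j) = A5 $$ (i, j)"
    and "i < q \<Longrightarrow> j < r \<Longrightarrow> M $$ (p + i, p + q + j) = A6 $$ (i, j)"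
    and "i < r \<Longrightarrow> j < p \<Longrightarrow> M $$ (p + q + i, j) = A7 $$ (i, j)"
    and "i < r \<Longrightarrow> j < q \<Longrightarrow> M $$ (p + q + i, p + j) = A8 $$ (i, j)"
    and "i < r \<Longrightarrow> j < r \<Longrightarrow> M $$ (p + q + i, p + q + j) = A9 $$ (i, j)"
  by (simp_all add: M_def block3_mat_index[OF A])

lemma block3_sum_entry:
  fixes X1 :: "'a :: semiring_0 mat"
  assumes "X1 \<in> carrier_mat k p" "X2 \<in> carrier_mat k q" "X3 \<in> carrier_mat k r"
    and "Y1 \<in> carrier_mat p l" "Y2 \<in> carrier_mat q l" "Y3 \<in> carrier_mat r l"
    and "i < k" "j < l"
  shows "(X1 * Y1 + X2 * Y2 + X3 * Y3) $$ (i, j) =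
    (\<Sum>c<p. X1 $$ (i, c) * Y1 $$ (c, j)) + (\<Sum>c<q. X2 $$ (i, c) * Y2 $$ (c, j)) +
    (\<Sum>c<r. X3 $$ (i, c) * Y3 $$ (c, j))"
  using assms by (simp add: scalar_prod_def lessThan_atLeast0)

lemma block3_mat_mult:
  fixes A1 :: "real mat"
  assumes A: "A1 \<in> carrier_mat p p" "A2 \<in> carrier_mat p q" "A3 \<in> carrier_mat p r"
      "A4 \<in> carrier_mat q p" "A5 \<in> carrier_mat q q" "A6 \<in> carrier_mat q r"
      "A7 \<in> carrier_mat r p" "A8 \<in> carrier_mat r q" "A9 \<in> carrier_mat r r"
    and B: "B1 \<in> carrier_mat p p" "B2 \<in> carrier_mat p q" "B3 \<in> carrier_mat p r"
      "B4 \<in> carrier_mat q p" "B5 \<in> carrier_mat q q" "B6 \<in> carrier_mat q r"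
      "B7 \<in> carrier_mat r p" "B8 \<in> carrier_mat r q" "B9 \<in> carrier_mat r r"
  shows "block3_mat A1 A2 A3 A4 A5 A6 A7 A8 A9 * block3_mat B1 B2 B3 B4 B5 B6 B7 B8 B9 =
    block3_mat
      (A1 * B1 + A2 * B4 + A3 * B7) (A1 * B2 + A2 * B5 + A3 * B8) (A1 * B3 + A2 * B6 + A3 * B9)
      (A4 * B1 + A5 * B4 + A6 * B7) (A4 * B2 + A5 * B5 + A6 * B8) (A4 * B3 + A5 * B6 + A6 * B9)
      (A7 * B1 + A8 * B4 + A9 * B7) (A7 * B2 + A8 * B5 + A9 * B8) (A7 * B3 + A8 * B6 + A9 * B9)"
    (is "?A * ?B = ?C")
proof (rule eq_matI)
  have cA: "?A \<in> carrier_mat (p + q + r) (p + q + r)" by (rule block3_mat_carrier) (use A in auto)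
  have cB: "?B \<in> carrier_mat (p + q + r) (p + q + r)" by (rule block3_mat_carrier) (use B in auto)
  have cC: "?C \<in> carrier_mat (p + q + r) (p + q + r)" by (rule block3_mat_carrier) (use A B in auto)
  show "dim_row (?A * ?B) = dim_row ?C" "dim_col (?A * ?B) = dim_col ?C" using cA cB cC by auto
  fix i j assume "i < dim_row ?C" "j < dim_col ?C"
  hence ij: "i < p + q + r" "j < p + q + r" using cC by auto
  \<comment> \<open>Locating both \<open>i\<close> and \<open>j\<close> in one of three ranges gives
    nine cases, one for each block of the product.\<close>
  have split: "\<exists>a. (k = a \<and> a < p) \<or> (k = p + a \<and> a < q) \<or> (k = p + q + a \<and> a < r)"
    if "k < p + q + r" for k
    using that by presburger
  have cs: "A1 * B1 + A2 * B4 + A3 * B7 \<in> carrier_mat p p" "A1 * B2 + A2 * B5 + A3 * B8 \<in> carrier_mat p q"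
    "A1 * B3 + A2 * B6 + A3 * B9 \<in> carrier_mat p r" "A4 * B1 + A5 * B4 + A6 * B7 \<in> carrier_mat q p"
    "A4 * B2 + A5 * B5 + A6 * B8 \<in> carrier_mat q q" "A4 * B3 + A5 * B6 + A6 * B9 \<in> carrier_mat q r"
    "A7 * B1 + A8 * B4 + A9 * B7 \<in> carrier_mat r p" "A7 * B2 + A8 * B5 + A9 * B8 \<in> carrier_mat r q"
    "A7 * B3 + A8 * B6 + A9 * B9 \<in> carrier_mat r r"
    using A B by auto
  note C_entries = block3_mat_entries[OF cs]
  have "(?A * ?B) $$ (i, j) = (\<Sum>k<p + q + r. ?A $$ (i, k) * ?B $$ (k, j))"
    using cA cB ij by (simp add: scalar_prod_def lessThan_atLeast0)
  also have "\<dots> = ?C $$ (i, j)"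
    using split[OF ij(1)] split[OF ij(2)]
    by (elim exE disjE conjE)
      (simp_all only: sum_lessThan_add3 C_entries block3_sum_entry[OF A(1,2,3) B(1,4,7)]
        block3_sum_entry[OF A(1,2,3) B(2,5,8)] block3_sum_entry[OF A(1,2,3) B(3,6,9)]
        block3_sum_entry[OF A(4,5,6) B(1,4,7)] block3_sum_entry[OF A(4,5,6) B(2,5,8)]
        block3_sum_entry[OF A(4,5,6) B(3,6,9)] block3_sum_entry[OF A(7,8,9) B(1,4,7)]
        block3_sum_entry[OF A(7,8,9) B(2,5,8)] block3_sum_entry[OF A(7,8,9) B(3,6,9)],
       auto simp: block3_mat_entries[OF A] block3_mat_entries[OF B] intro!: arg_cong2[where f = "(+)"] sum.cong)
  finally show "(?A * ?B) $$ (i, j) = ?C $$ (i, j)" .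
qed

lemma block3_mat_minus:
  fixes A1 :: "real mat"
  assumes A: "A1 \<in> carrier_mat p p" "A2 \<in> carrier_mat p q" "A3 \<in> carrier_mat p r"
      "A4 \<in> carrier_mat q p" "A5 \<in> carrier_mat q q" "A6 \<in> carrier_mat q r"
      "A7 \<in> carrier_mat r p" "A8 \<in> carrier_mat r q" "A9 \<in> carrier_mat r r"
    and B: "B1 \<in> carrier_mat p p" "B2 \<in> carrier_mat p q" "B3 \<in> carrier_mat p r"
      "B4 \<in> carrier_mat q p" "B5 \<in> carrier_mat q q" "B6 \<in> carrier_mat q r"
      "B7 \<in> carrier_mat r p" "B8 \<in> carrier_mat r q" "B9 \<in> carrier_mat r r"
  shows "block3_mat A1 A2 A3 A4 A5 A6 A7 A8 A9 - block3_mat B1 B2 B3 B4 B5 B6 B7 B8 B9 =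
    block3_mat (A1 - B1) (A2 - B2) (A3 - B3) (A4 - B4) (A5 - B5) (A6 - B6) (A7 - B7) (A8 - B8) (A9 - B9)"
    (is "?A - ?B = ?C")
proof (rule eq_matI)
  have cA: "?A \<in> carrier_mat (p + q + r) (p + q + r)" by (rule block3_mat_carrier) (use A in auto)
  have cB: "?B \<in> carrier_mat (p + q + r) (p + q + r)" by (rule block3_mat_carrier) (use B in auto)
  have cC: "?C \<in> carrier_mat (p + q + r) (p + q + r)"
    by (rule block3_mat_carrier) (use A B in \<open>auto intro: minus_carrier_mat\<close>)
  show "dim_row (?A - ?B) = dim_row ?C" "dim_col (?A - ?B) = dim_col ?C" using cA cB cC by auto
  fix i j assume "i < dim_row ?C" "j < dim_col ?C"
  hence ij: "i < p + q + r" "j < p + q + r" using cC by auto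
  have "?C $$ (i, j) = ?A $$ (i, j) - ?B $$ (i, j)"
    unfolding block3_mat_index[OF A ij] block3_mat_index[OF B ij]
    by (subst block3_mat_index[of _ p _ q _ r]) (use A B ij in \<open>auto intro: minus_carrier_mat\<close>)
  thus "(?A - ?B) $$ (i, j) = ?C $$ (i, j)" using cA cB ij by simp
qed

lemma block3_mat_one:
  "block3_mat (1\<^sub>m p) (0\<^sub>m p q) (0\<^sub>m p r) (0\<^sub>m q p) (1\<^sub>m q) (0\<^sub>m q r) (0\<^sub>m r p) (0\<^sub>m r q) (1\<^sub>m r)
    = 1\<^sub>m (p + q + r)"
  by (rule eq_matI) (auto simp: block3_mat_def append_rows_def)

lemma block3_mat_zero:
  "block3_mat (0\<^sub>m p p) (0\<^sub>m p q) (0\<^sub>m p r) (0\<^sub>m q p) (0\<^sub>m q q) (0\<^sub>m q r) (0\<^sub>m r p) (0\<^sub>m r q) (0\<^sub>m r r)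
    = 0\<^sub>m (p + q + r) (p + q + r)"
  by (rule eq_matI) (auto simp: block3_mat_def append_rows_def)

section \<open>The dual-minus sharp order\<close>

lemma mat_minus_self: "A - A = 0\<^sub>m (dim_row A) (dim_col (A :: 'a :: ab_group_add mat))"
  by (rule eq_matI) auto

text \<open>Taking real parts is multiplicative, so the real part of a dual group inverse is an
  inner inverse of \<open>E\<close> that commutes with it.\<close>

lemma DGGI_std:
  assumes E: "E \<in> carrier_mat n n" "E0 \<in> carrier_mat n n" and G: "dual_mat E E0 \<in> DCM n"
  obtains X where "X \<in> carrier_mat n n" "E * X * E = E" "E * X = X * E"
proof -
  obtain X where X: "is_DGGI (dual_mat E E0) X" using G by (auto simp: DCM_def)
  hence "X \<in> carrier_mat n n" using E by (simp add: is_DGGI_def)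
  then obtain Y Y0 where Y: "Y \<in> carrier_mat n n" "Y0 \<in> carrier_mat n n" "X = dual_mat Y Y0"
    by (rule dual_mat_cases)
  have EY: "E * Y \<in> carrier_mat n n" "E * Y0 + E0 * Y \<in> carrier_mat n n"
    "Y * E \<in> carrier_mat n n" "Y * E0 + Y0 * E \<in> carrier_mat n n" using E Y(1,2) by auto
  have 1: "dual_mat E E0 * X = dual_mat (E * Y) (E * Y0 + E0 * Y)"
    unfolding Y(3) by (rule dual_mat_mult[OF E Y(1,2)])
  have 2: "X * dual_mat E E0 = dual_mat (Y * E) (Y * E0 + Y0 * E)"
    unfolding Y(3) by (rule dual_mat_mult[OF Y(1,2) E])
  have "dual_mat (E * Y) (E * Y0 + E0 * Y) = dual_mat (Y * E) (Y * E0 + Y0 * E)"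
    using X by (simp add: is_DGGI_def flip: 1 2)
  hence "E * Y = Y * E" using EY by (rule dual_mat_eqD(1))
  moreover have "dual_mat (E * Y * E) (E * Y * E0 + (E * Y0 + E0 * Y) * E) = dual_mat E E0"
    using X unfolding is_DGGI_def dual_mat_mult[OF EY(1,2) E, symmetric] 1[symmetric] by blast
  hence "E * Y * E = E"
    by (rule dual_mat_eqD(1)[where m = n and n = n]) (use E Y(1,2) EY in auto)
  ultimately show ?thesis using that Y by blast
qed

lemma rank_std_square:
  assumes "E \<in> carrier_mat n n" "E0 \<in> carrier_mat n n" "dual_mat E E0 \<in> DCM n"
  shows "vec_space.rank n (E * E) = vec_space.rank n E"
  using DGGI_std[OF assms] rank_square_eq[OF assms(1)] by metis

section \<open>From the order to the block form\<close>

lemma invertible_matI: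
  fixes A B :: "real mat"
  assumes "A \<in> carrier_mat k k" "B \<in> carrier_mat k k" "A * B = 1\<^sub>m k"
  shows "invertible_mat A"
  using assms mat_mult_left_right_inverse[OF assms]
  by (auto simp: invertible_mat_def inverts_mat_def)

text \<open>Identifies an explicitly constructed left inverse with \<open>inv_mat P\<close>; for
  square matrices it is automatically a right inverse.\<close>

lemma inv_mat_unique:
  assumes P: "P \<in> carrier_mat n n" and Q: "Q \<in> carrier_mat n n" and "Q * P = 1\<^sub>m n"
  shows "invertible_mat P" "inv_mat P = Q" "P * Q = 1\<^sub>m n"
proof -
  show PQ: "P * Q = 1\<^sub>m n" using mat_mult_left_right_inverse[OF Q P assms(3)] .
  show inv: "invertible_mat P" using invertible_matI[OF P Q PQ] .
  have "inv_mat P = Q * P * inv_mat P" using inv_mat[OF P inv] assms(3) by simp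
  also have "\<dots> = Q * (P * inv_mat P)"
    using P Q inv_mat(1)[OF P inv] by (simp add: mat_mult_assoc_dim)
  also have "\<dots> = Q" using inv_mat[OF P inv] Q by simp
  finally show "inv_mat P = Q" .
qed

text \<open>Inserting identities gives
  \<open>R1 C2 = (R1 C1)(R1 C2)(R2 C2) = R1 (C1 R1 C2 R2) C2\<close>, with a zero product in the
  middle. Orthogonality of idempotents thus passes to their factors.\<close>

lemma factor_orthogonal:
  fixes C1 :: "'a :: comm_ring_1 mat"
  assumes C1: "C1 \<in> carrier_mat n p" and R1: "R1 \<in> carrier_mat p n"
    and C2: "C2 \<in> carrier_mat n q" and R2: "R2 \<in> carrier_mat q n"
    and "R1 * C1 = 1\<^sub>m p" "R2 * C2 = 1\<^sub>m q" and zero: "C1 * R1 * (C2 * R2) = 0\<^sub>m n n"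
  shows "R1 * C2 = 0\<^sub>m p q"
proof -
  have "R1 * C2 = (R1 * C1) * (R1 * C2) * (R2 * C2)" using assms by simp
  also have "\<dots> = R1 * (C1 * R1 * (C2 * R2)) * C2" using assms(1-4) by (simp add: mat_mult_assoc_dim)
  also have "\<dots> = 0\<^sub>m p q" unfolding zero using R1 C2 by simp
  finally show ?thesis .
qed

text \<open>In the constructed basis, block \<open>(i, j)\<close> of any matrix \<open>M\<close> is
  \<open>Ri M Cj\<close>. The block form therefore amounts to knowing which rows \<open>Ri\<close>
  and columns \<open>Cj\<close> annihilate \<open>E\<close>, \<open>F\<close> and
  \<open>F - E\<close>.\<close>

lemma sharp_le_forward:
  fixes E E0 F F0 :: "real mat"
  assumes E: "E \<in> carrier_mat n n" "E0 \<in> carrier_mat n n"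
    and F: "F \<in> carrier_mat n n" "F0 \<in> carrier_mat n n"
    and GE: "dual_mat E E0 \<in> DCM n" and GF: "dual_mat F F0 \<in> DCM n"
    and EF: "E * F = E * E" and FE: "F * E = E * E"
    and MP: "is_DMPGI (dual_mat F F0 - dual_mat E E0) X"
  obtains P Q p q r D1 D2 E1 E2 E3 E4 E7 F2 F4 F5 F6 F8 where
    "n = p + q + r" "vec_space.rank n E = p" "vec_space.rank n F = p + q"
    "P \<in> carrier_mat n n" "Q \<in> carrier_mat n n" "Q * P = 1\<^sub>m n"
    "D1 \<in> carrier_mat p p" "D2 \<in> carrier_mat q q"
    "E1 \<in> carrier_mat p p" "E2 \<in> carrier_mat p q" "E3 \<in> carrier_mat p r"
    "E4 \<in> carrier_mat q p" "E7 \<in> carrier_mat r p"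
    "F2 \<in> carrier_mat p q" "F4 \<in> carrier_mat q p" "F5 \<in> carrier_mat q q"
    "F6 \<in> carrier_mat q r" "F8 \<in> carrier_mat r q"
    "invertible_mat D1" "invertible_mat D2"
    "E = P * block3_mat D1 (0\<^sub>m p q) (0\<^sub>m p r) (0\<^sub>m q p) (0\<^sub>m q q) (0\<^sub>m q r) (0\<^sub>m r p) (0\<^sub>m r q) (0\<^sub>m r r) * Q"
    "E0 = P * block3_mat E1 E2 E3 E4 (0\<^sub>m q q) (0\<^sub>m q r) E7 (0\<^sub>m r q) (0\<^sub>m r r) * Q"
    "F = P * block3_mat D1 (0\<^sub>m p q) (0\<^sub>m p r) (0\<^sub>m q p) D2 (0\<^sub>m q r) (0\<^sub>m r p) (0\<^sub>m r q) (0\<^sub>m r r) * Q"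
    "F0 = P * block3_mat E1 F2 E3 F4 F5 F6 E7 F8 (0\<^sub>m r r) * Q"
proof -
  obtain Y where Y: "Y \<in> carrier_mat n n" and EYE: "E * Y * E = E" and EY: "E * Y = Y * E"
    using DGGI_std[OF E GE] .
  obtain Z where Z: "Z \<in> carrier_mat n n" and FZF: "F * Z * F = F" and FZ: "F * Z = Z * F"
    using DGGI_std[OF F GF] .
  note d = carrier_matD[OF E(1)] carrier_matD[OF E(2)] carrier_matD[OF F(1)] carrier_matD[OF F(2)]
    carrier_matD[OF Y] carrier_matD[OF Z]
  note assoc = mat_mult_assoc_dim
  \<comment> \<open>Since \<open>Y\<close> and \<open>Z\<close> commute with \<open>E\<close> and
    \<open>F\<close>, these idempotents act as identities on both sides of \<open>E\<close> and
    \<open>F\<close> respectively.\<close>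
  define U V where "U = E * Y" and "V = F * Z"
  have U: "U \<in> carrier_mat n n" and V: "V \<in> carrier_mat n n" using E F Y Z by (auto simp: U_def V_def)
  note d = d carrier_matD[OF U] carrier_matD[OF V]
  have UE: "U * E = E" by (simp add: U_def EYE)
  have EU: "E * U = E"
  proof -
    have "E * U = E * Y * E" unfolding U_def EY using d by (simp add: assoc flip: EY)
    thus ?thesis by (simp add: EYE)
  qed
  have VF: "V * F = F" by (simp add: V_def FZF)
  have FV: "F * V = F"
  proof -
    have "F * V = F * Z * F" unfolding V_def FZ using d by (simp add: assoc flip: FZ)
    thus ?thesis by (simp add: FZF)
  qed
  have FEY: "F * U = E"
  proof -
    have "F * U = F * E * Y" unfolding U_def using d by (simp add: assoc)
    also have "\<dots> = E * U" unfolding FE U_def using d by (simp add: assoc)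
    finally show ?thesis by (simp add: EU)
  qed
  have UF: "U * F = E"
  proof -
    have "U * F = Y * (E * F)" unfolding U_def EY using d by (simp add: assoc)
    also have "\<dots> = U * E" unfolding EF U_def EY using d by (simp add: assoc)
    finally show ?thesis by (simp add: UE)
  qed
  have VE: "V * E = E"
  proof -
    have "V * E = V * F * U" using d by (simp add: assoc FEY)
    thus ?thesis by (simp add: VF FEY)
  qed
  have EV: "E * V = E"
  proof -
    have "E * V = U * (F * V)" using d by (simp add: UF flip: assoc)
    thus ?thesis by (simp add: FV UF)
  qed
  have UU: "U * U = U" unfolding U_def using d by (simp add: EYE flip: assoc)
  have VV: "V * V = V" unfolding V_def using d by (simp add: FZF flip: assoc)
  have VU: "V * U = U"
  proof -
    have "V * U = V * E * Y" unfolding U_def using d by (simp add: assoc)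
    thus ?thesis by (simp add: VE U_def)
  qed
  have UV: "U * V = U"
  proof -
    have "U * V = Y * (E * V)" unfolding U_def EY using d by (simp add: assoc)
    thus ?thesis by (simp add: EV U_def EY)
  qed
  let ?I = "1\<^sub>m n :: real mat"
  \<comment> \<open>Together with \<open>U\<close>, these form the resolution
    \<open>U + T + W = I\<close> into mutually orthogonal idempotents.\<close>
  define T W where "T = V - U" and "W = ?I - V"
  have T: "T \<in> carrier_mat n n" and W: "W \<in> carrier_mat n n"
    using U V by (auto simp: T_def W_def minus_carrier_mat)
  have TT: "T * T = T"
  proof -
    have "T * T = (V * V - V * U) - (U * V - U * U)"
      unfolding T_def using d by (simp add: mat_minus_mult_distrib_dim mat_mult_minus_distrib_dim)
        (auto intro!: eq_matI simp del: index_mult_mat(1))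
    also have "\<dots> = T" unfolding VV VU UV UU T_def using U V by (auto intro!: eq_matI)
    finally show ?thesis .
  qed
  have UT: "U * T = 0\<^sub>m n n" and TU: "T * U = 0\<^sub>m n n" and VT: "V * T = T"
    unfolding T_def using U V
    by (simp_all add: mat_minus_mult_distrib_dim mat_mult_minus_distrib_dim UV UU VU VV)
  have UW: "U * W = 0\<^sub>m n n" and WU: "W * U = 0\<^sub>m n n" and WV: "W * V = 0\<^sub>m n n" and VW: "V * W = 0\<^sub>m n n"
    unfolding W_def using U V
    by (simp_all add: mat_minus_mult_distrib_dim mat_mult_minus_distrib_dim UV VU VV)
  have WW: "W * W = W"
  proof -
    have "W * W = W - W * V"
      using W V by (subst (2) W_def) (simp add: mat_mult_minus_distrib_dim)
    thus ?thesis using W by (auto simp: WV intro!: eq_matI)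
  qed
  have TW: "T * W = 0\<^sub>m n n" and WT: "W * T = 0\<^sub>m n n"
    unfolding T_def using U V W
    by (simp_all add: mat_minus_mult_distrib_dim mat_mult_minus_distrib_dim UW WU VW WV)
  define p q r where "p = vec_space.rank n E" and "q = vec_space.rank n T" and "r = vec_space.rank n W"
  have tr: "trace_mat U = real p" "trace_mat V = real (vec_space.rank n F)"
    unfolding p_def U_def V_def using rank_eq_trace E F Y Z EYE FZF by metis+
  \<comment> \<open>An idempotent has the identity matrix as an inner inverse, so its rank is its
    own trace.\<close>
  have tr': "trace_mat T = real q" "trace_mat W = real r"
    unfolding q_def r_def
    using rank_eq_trace[OF T one_carrier_mat] rank_eq_trace[OF W one_carrier_mat] T W TT WW by auto
  have rank_F: "vec_space.rank n F = p + q"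
    using tr tr'(1) trace_mat_minus[OF V U] by (simp add: T_def)
  have n: "n = p + q + r"
    using tr tr'(2) trace_mat_minus[OF one_carrier_mat V] rank_F by (simp add: W_def trace_mat_one)
  obtain C1 R1 where C1: "C1 \<in> carrier_mat n p" and R1: "R1 \<in> carrier_mat p n"
    and CR1: "C1 * R1 = U" and RC1: "R1 * C1 = 1\<^sub>m p"
    using inner_inverse_factorization[OF E(1) Y EYE] unfolding p_def U_def by metis
  obtain C2 R2 where C2: "C2 \<in> carrier_mat n q" and R2: "R2 \<in> carrier_mat q n"
    and CR2: "C2 * R2 = T" and RC2: "R2 * C2 = 1\<^sub>m q"
    using inner_inverse_factorization[OF T one_carrier_mat] T TT unfolding q_def
    by (metis right_mult_one_mat)
  obtain C3 R3 where C3: "C3 \<in> carrier_mat n r" and R3: "R3 \<in> carrier_mat r n"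
    and CR3: "C3 * R3 = W" and RC3: "R3 * C3 = 1\<^sub>m r"
    using inner_inverse_factorization[OF W one_carrier_mat] W WW unfolding r_def
    by (metis right_mult_one_mat)
  note C = C1 C2 C3 and R = R1 R2 R3
  note orth =
    factor_orthogonal[OF C1 R1 C2 R2 RC1 RC2, unfolded CR1 CR2, OF UT]
    factor_orthogonal[OF C1 R1 C3 R3 RC1 RC3, unfolded CR1 CR3, OF UW]
    factor_orthogonal[OF C2 R2 C1 R1 RC2 RC1, unfolded CR2 CR1, OF TU]
    factor_orthogonal[OF C2 R2 C3 R3 RC2 RC3, unfolded CR2 CR3, OF TW]
    factor_orthogonal[OF C3 R3 C1 R1 RC3 RC1, unfolded CR3 CR1, OF WU]
    factor_orthogonal[OF C3 R3 C2 R2 RC3 RC2, unfolded CR3 CR2, OF WT]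
  define P Q where "P = hcat3 C1 C2 C3"
    and "Q = transpose_mat (hcat3 (transpose_mat R1) (transpose_mat R2) (transpose_mat R3))"
  have P: "P \<in> carrier_mat n n" unfolding P_def using hcat3_carrier[OF C] n by simp
  have "hcat3 (transpose_mat R1) (transpose_mat R2) (transpose_mat R3) \<in> carrier_mat n (p + q + r)"
    by (rule hcat3_carrier) (use R in auto)
  hence Q: "Q \<in> carrier_mat n n" unfolding Q_def using n by simp
  note conj = conj_hcat3_eq_block3[OF _ C R, folded P_def Q_def]
  \<comment> \<open>The blocks of \<open>Q P\<close> are the products \<open>Ri Cj\<close>:
    identities on the diagonal and, by orthogonality, zeros elsewhere.\<close>
  have "Q * P = Q * ?I * P" using Q by simp
  also have "\<dots> = block3_mat (R1 * C1) (R1 * C2) (R1 * C3) (R2 * C1) (R2 * C2) (R2 * C3)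
      (R3 * C1) (R3 * C2) (R3 * C3)"
    unfolding conj[OF one_carrier_mat] using R by simp
  also have "\<dots> = ?I" unfolding orth RC1 RC2 RC3 using block3_mat_one n by simp
  finally have QP: "Q * P = ?I" .
  have PQ: "P * Q = ?I" by (rule inv_mat_unique(3)[OF P Q QP])
  have decomp: "M = P * block3_mat (R1 * M * C1) (R1 * M * C2) (R1 * M * C3)
      (R2 * M * C1) (R2 * M * C2) (R2 * M * C3) (R3 * M * C1) (R3 * M * C2) (R3 * M * C3) * Q"
    if M: "M \<in> carrier_mat n n" for M
  proof -
    have "P * (Q * M * P) * Q = (P * Q) * M * (P * Q)" using P Q M by (simp add: assoc)
    thus ?thesis using M by (simp add: PQ conj[OF M])
  qed
  note d = d carrier_matD[OF C1] carrier_matD[OF C2] carrier_matD[OF C3]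
    carrier_matD[OF R1] carrier_matD[OF R2] carrier_matD[OF R3]
  \<comment> \<open>\<open>U * M = M\<close> makes \<open>M\<close> factor through \<open>C1\<close>
    on the left, so whatever kills \<open>C1\<close> kills \<open>M\<close>. \<open>zeroC\<close> is
    the mirror image.\<close>
  have zeroR: "K * M = 0\<^sub>m k n" if "K \<in> carrier_mat k n" "M \<in> carrier_mat n n" "U * M = M" "K * C1 = 0\<^sub>m k p"
    for K M :: "real mat" and k
  proof -
    have "K * M = K * (U * M)" by (simp add: that(3))
    also have "\<dots> = K * C1 * (R1 * M)" unfolding CR1[symmetric] using that(1,2) d by (simp add: assoc)
    also have "\<dots> = 0\<^sub>m k n" unfolding that(4) using that(2) R1 by simp
    finally show ?thesis .
  qed
  have zeroC: "M * L = 0\<^sub>m n l" if "L \<in> carrier_mat n l" "M \<in> carrier_mat n n" "M * U = M" "R1 * L = 0\<^sub>m p l"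
    for L M :: "real mat" and l
  proof -
    have "M * L = M * U * L" by (simp add: that(3))
    also have "\<dots> = M * C1 * (R1 * L)" unfolding CR1[symmetric] using that(1,2) d by (simp add: assoc)
    also have "\<dots> = 0\<^sub>m n l" unfolding that(4) using that(2) C1 by simp
    finally show ?thesis .
  qed
  have R2E: "R2 * E = 0\<^sub>m q n" and R3E: "R3 * E = 0\<^sub>m r n"
    using zeroR[OF R2 E(1) UE] zeroR[OF R3 E(1) UE] orth by auto
  have EC2: "E * C2 = 0\<^sub>m n q" and EC3: "E * C3 = 0\<^sub>m n r"
    using zeroC[OF C2 E(1) EU] zeroC[OF C3 E(1) EU] orth by auto
  have R3F: "R3 * F = 0\<^sub>m r n"
  proof -
    have "R3 * F = (R3 * C3) * R3 * (V * F)" using R3 by (simp add: RC3 VF)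
    also have "\<dots> = R3 * (C3 * R3 * V) * F" using d by (simp add: assoc)
    also have "\<dots> = 0\<^sub>m r n" unfolding CR3 WV using R3 F by simp
    finally show ?thesis .
  qed
  have FC3: "F * C3 = 0\<^sub>m n r"
  proof -
    have "F * C3 = (F * V) * C3 * (R3 * C3)" using C3 by (simp add: RC3 FV)
    also have "\<dots> = F * (V * (C3 * R3)) * C3" using d by (simp add: assoc)
    also have "\<dots> = 0\<^sub>m n r" unfolding CR3 VW using C3 F by simp
    finally show ?thesis .
  qed
  have R1F: "R1 * F = R1 * E"
  proof -
    have "R1 * F = (R1 * C1) * R1 * F" using R1 by (simp add: RC1)
    also have "\<dots> = R1 * (C1 * R1 * F)" using d by (simp add: assoc)
    finally show ?thesis by (simp add: CR1 UF)
  qed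
  have FC1: "F * C1 = E * C1"
  proof -
    have "F * C1 = F * C1 * (R1 * C1)" using F C1 by (simp add: RC1)
    also have "\<dots> = F * (C1 * R1) * C1" using d by (simp add: assoc)
    finally show ?thesis by (simp add: CR1 FEY)
  qed
  \<comment> \<open>The inverse is the corresponding block \<open>R1 * Y * C1\<close>.\<close>
  have D1: "invertible_mat (R1 * E * C1)"
  proof (rule invertible_matI)
    have "R1 * E * C1 * (R1 * Y * C1) = R1 * (E * (C1 * R1)) * Y * C1" using d by (simp add: assoc)
    also have "\<dots> = R1 * U * C1" unfolding CR1 EU unfolding U_def using d by (simp add: assoc)
    also have "\<dots> = (R1 * C1) * (R1 * C1)" unfolding CR1[symmetric] using d by (simp add: assoc)
    finally show "R1 * E * C1 * (R1 * Y * C1) = 1\<^sub>m p" by (simp add: RC1)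
  qed (use R1 C1 E Y in auto)
  \<comment> \<open>The inverse is \<open>R2 * Z * C2\<close>. Between the two factors
    \<open>C2 * R2 = T\<close> appears, and \<open>F T = F - E\<close> reduces to \<open>F\<close>
    after multiplication by \<open>R2\<close>, since \<open>R2 E = O\<close>.\<close>
  have D2: "invertible_mat (R2 * F * C2)"
  proof (rule invertible_matI)
    have FT: "F * T = F - E"
      unfolding T_def using d by (simp add: mat_mult_minus_distrib_dim FV FEY)
    have "R2 * F * C2 * (R2 * Z * C2) = R2 * (F * (C2 * R2)) * Z * C2" using d by (simp add: assoc)
    also have "\<dots> = (R2 * F - R2 * E) * Z * C2"
      unfolding CR2 FT using d by (simp add: mat_mult_minus_distrib_dim)
    also have "R2 * F - R2 * E = R2 * F" unfolding R2E using R2 F by (auto intro!: eq_matI)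
    also have "R2 * F * Z * C2 = R2 * V * (C2 * (R2 * C2))"
      unfolding V_def RC2 using d C2 by (simp add: assoc)
    also have "\<dots> = R2 * (V * (C2 * R2)) * C2" using d by (simp add: assoc)
    also have "\<dots> = (R2 * C2) * (R2 * C2)" unfolding CR2 VT unfolding CR2[symmetric] using d by (simp add: assoc)
    finally show "R2 * F * C2 * (R2 * Z * C2) = 1\<^sub>m q" by (simp add: RC2)
  qed (use R2 C2 F Z in auto)
  obtain XE where "XE \<in> carrier_mat n n" "dual_mat E E0 * XE * dual_mat E E0 = dual_mat E E0"
    using GE E by (auto simp: DCM_def is_DGGI_def)
  note E0_zero = inner_inverse_inft_zero[OF E this]
  obtain XF where "XF \<in> carrier_mat n n" "dual_mat F F0 * XF * dual_mat F F0 = dual_mat F F0"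
    using GF F by (auto simp: DCM_def is_DGGI_def)
  note F0_zero = inner_inverse_inft_zero[OF F this]
  have G: "F - E \<in> carrier_mat n n" "F0 - E0 \<in> carrier_mat n n"
    using E F by (auto intro: minus_carrier_mat)
  have "X \<in> carrier_mat n n"
    "dual_mat (F - E) (F0 - E0) * X * dual_mat (F - E) (F0 - E0) = dual_mat (F - E) (F0 - E0)"
    using MP E F unfolding is_DMPGI_def dual_mat_minus[OF F E] by auto
  note G0_zero = inner_inverse_inft_zero[OF G this]
  \<comment> \<open>The difference \<open>F - E\<close> lives in the middle block only, so its
    infinitesimal part must vanish in the four corners: there \<open>E0\<close> and
    \<open>F0\<close> agree.\<close>
  have RG: "R1 * (F - E) = 0\<^sub>m p n" "R3 * (F - E) = 0\<^sub>m r n"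
    using d by (simp_all add: mat_mult_minus_distrib_dim R1F R3F R3E mat_minus_self)
  have GC: "(F - E) * C1 = 0\<^sub>m n p" "(F - E) * C3 = 0\<^sub>m n r"
    using d by (simp_all add: mat_minus_mult_distrib_dim FC1 FC3 EC3 mat_minus_self)
  have same: "K * F0 * L = K * E0 * L"
    if "K \<in> carrier_mat k n" "L \<in> carrier_mat n l" "K * (F - E) = 0\<^sub>m k n" "(F - E) * L = 0\<^sub>m n l"
    for K L :: "real mat" and k l
  proof (rule mat_minus_eq_zeroD)
    have "K * F0 * L - K * E0 * L = K * (F0 - E0) * L"
      using d that(1,2) by (simp add: mat_mult_minus_distrib_dim mat_minus_mult_distrib_dim)
    thus "K * F0 * L - K * E0 * L = 0\<^sub>m k l" by (simp add: G0_zero[OF that(1,3,2,4)])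
  qed (use E F that in auto)
  have zero_left: "0\<^sub>m k n * L = 0\<^sub>m k l" if "L \<in> carrier_mat n l" for L :: "real mat" and k l
    using that by simp
  have zero_right: "K * F * C3 = 0\<^sub>m k r" if "K \<in> carrier_mat k n" for K :: "real mat" and k
    using that d by (simp add: assoc FC3)
  have "R1 * E * C2 = 0\<^sub>m p q" "R1 * E * C3 = 0\<^sub>m p r"
    using R1 d by (simp_all add: assoc EC2 EC3)
  note blE = this zero_left[OF C1] zero_left[OF C2] zero_left[OF C3]
  have "R2 * F * C1 = 0\<^sub>m q p"
  proof -
    have "R2 * F * C1 = R2 * E * C1" using d by (simp add: assoc FC1)
    thus ?thesis by (simp add: R2E zero_left[OF C1])
  qed
  note blF = this zero_right[OF R2]
  have E_eq: "E = P * block3_mat (R1 * E * C1) (0\<^sub>m p q) (0\<^sub>m p r) (0\<^sub>m q p) (0\<^sub>m q q) (0\<^sub>m q r)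
      (0\<^sub>m r p) (0\<^sub>m r q) (0\<^sub>m r r) * Q"
    using decomp[OF E(1)] unfolding R2E R3E blE .
  have F_eq: "F = P * block3_mat (R1 * E * C1) (0\<^sub>m p q) (0\<^sub>m p r) (0\<^sub>m q p) (R2 * F * C2) (0\<^sub>m q r)
      (0\<^sub>m r p) (0\<^sub>m r q) (0\<^sub>m r r) * Q"
    using decomp[OF F(1)] unfolding R1F R3F blF blE .
  have E0_eq: "E0 = P * block3_mat (R1 * E0 * C1) (R1 * E0 * C2) (R1 * E0 * C3) (R2 * E0 * C1)
      (0\<^sub>m q q) (0\<^sub>m q r) (R3 * E0 * C1) (0\<^sub>m r q) (0\<^sub>m r r) * Q"
    using decomp[OF E(2)]
    unfolding E0_zero[OF R2 R2E C2 EC2] E0_zero[OF R2 R2E C3 EC3]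
      E0_zero[OF R3 R3E C2 EC2] E0_zero[OF R3 R3E C3 EC3] .
  \<comment> \<open>The last diagonal block vanishes by the criterion for \<open>F\<close>; the
    other three corners are copied from \<open>E0\<close> by the criterion for
    \<open>F - E\<close>.\<close>
  have F0_eq: "F0 = P * block3_mat (R1 * E0 * C1) (R1 * F0 * C2) (R1 * E0 * C3) (R2 * F0 * C1)
      (R2 * F0 * C2) (R2 * F0 * C3) (R3 * E0 * C1) (R3 * F0 * C2) (0\<^sub>m r r) * Q"
    using decomp[OF F(2)]
    unfolding F0_zero[OF R3 R3F C3 FC3] same[OF R1 C1 RG(1) GC(1)] same[OF R1 C3 RG(1) GC(2)]
      same[OF R3 C1 RG(2) GC(1)] .
  show ?thesis
    by (rule that[OF n p_def[symmetric] rank_F P Q QP _ _ _ _ _ _ _ _ _ _ _ _ D1 D2 E_eq E0_eq F_eq F0_eq])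
      (use C R E F in auto)
qed

section \<open>From the block form back to the order\<close>

lemma conj_mult:
  fixes P :: "'a :: comm_ring_1 mat"
  assumes "P \<in> carrier_mat n n" "Q \<in> carrier_mat n n" "Q * P = 1\<^sub>m n"
    and "A \<in> carrier_mat n n" "B \<in> carrier_mat n n"
  shows "P * A * Q * (P * B * Q) = P * (A * B) * Q"
proof -
  have "P * A * Q * (P * B * Q) = P * A * (Q * P) * B * Q"
    using assms(1,2,4,5) by (simp add: mat_mult_assoc_dim)
  thus ?thesis unfolding assms(3) using assms(1,2,4,5) by (simp add: mat_mult_assoc_dim)
qed

lemma conj_minus:
  fixes P :: "'a :: comm_ring_1 mat"
  assumes "P \<in> carrier_mat n n" "Q \<in> carrier_mat n n" "A \<in> carrier_mat n n" "B \<in> carrier_mat n n"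
  shows "P * A * Q - P * B * Q = P * (A - B) * Q"
  using assms by (simp add: mat_mult_minus_distrib_dim mat_minus_mult_distrib_dim)

text \<open>The middle diagonal block of \<open>F - E\<close> is invertible and the infinitesimal part of the
  difference vanishes in the four corner blocks, which is the criterion of \<open>DMPGI_exists\<close>.\<close>

lemma sharp_le_backward:
  fixes P Q D1 D2 :: "real mat"
  assumes n: "n = p + q + r"
    and P: "P \<in> carrier_mat n n" and Q: "Q \<in> carrier_mat n n" and QP: "Q * P = 1\<^sub>m n"
    and D: "D1 \<in> carrier_mat p p" "D2 \<in> carrier_mat q q" and inv: "invertible_mat D2"
    and B: "E1 \<in> carrier_mat p p" "E2 \<in> carrier_mat p q" "E3 \<in> carrier_mat p r"
      "E4 \<in> carrier_mat q p" "E7 \<in> carrier_mat r p"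
      "F2 \<in> carrier_mat p q" "F4 \<in> carrier_mat q p" "F5 \<in> carrier_mat q q"
      "F6 \<in> carrier_mat q r" "F8 \<in> carrier_mat r q"
    and E: "E = P * block3_mat D1 (0\<^sub>m p q) (0\<^sub>m p r) (0\<^sub>m q p) (0\<^sub>m q q) (0\<^sub>m q r) (0\<^sub>m r p) (0\<^sub>m r q) (0\<^sub>m r r) * Q"
      (is "E = P * ?BE * Q")
    and E0: "E0 = P * block3_mat E1 E2 E3 E4 (0\<^sub>m q q) (0\<^sub>m q r) E7 (0\<^sub>m r q) (0\<^sub>m r r) * Q"
      (is "E0 = P * ?BEe * Q")
    and F: "F = P * block3_mat D1 (0\<^sub>m p q) (0\<^sub>m p r) (0\<^sub>m q p) D2 (0\<^sub>m q r) (0\<^sub>m r p) (0\<^sub>m r q) (0\<^sub>m r r) * Q"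
      (is "F = P * ?BF * Q")
    and F0: "F0 = P * block3_mat E1 F2 E3 F4 F5 F6 E7 F8 (0\<^sub>m r r) * Q"
      (is "F0 = P * ?BFe * Q")
  shows "E * F = E * E" "F * E = E * E" "\<exists>X. is_DMPGI (dual_mat F F0 - dual_mat E E0) X"
proof -
  have cs: "?BE \<in> carrier_mat n n" "?BEe \<in> carrier_mat n n" "?BF \<in> carrier_mat n n" "?BFe \<in> carrier_mat n n"
    unfolding n by (rule block3_mat_carrier; use D B in simp)+
  have "?BE * ?BF = ?BE * ?BE" "?BF * ?BE = ?BE * ?BE"
    by (subst (1 2) block3_mat_mult[of _ p _ q _ r]; use D in simp)+
  thus "E * F = E * E" "F * E = E * E"
    unfolding E F using cs by (simp_all add: conj_mult[OF P Q QP])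
  define D2' where "D2' = inv_mat D2"
  have D2': "D2' \<in> carrier_mat q q" "D2 * D2' = 1\<^sub>m q" "D2' * D2 = 1\<^sub>m q"
    unfolding D2'_def by (rule inv_mat[OF D(2) inv])+
  let ?mid = "\<lambda>A. block3_mat (0\<^sub>m p p) (0\<^sub>m p q) (0\<^sub>m p r) (0\<^sub>m q p) A (0\<^sub>m q r) (0\<^sub>m r p) (0\<^sub>m r q) (0\<^sub>m r r) :: real mat"
  have mid: "?mid A \<in> carrier_mat n n" if "A \<in> carrier_mat q q" for A
    unfolding n by (rule block3_mat_carrier) (use that in auto)
  have mid_mult: "?mid A * ?mid A' = ?mid (A * A')" if "A \<in> carrier_mat q q" "A' \<in> carrier_mat q q" for A A'
    using that by (subst block3_mat_mult[of _ p _ q _ r]) simp_all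
  \<comment> \<open>The infinitesimal part of the difference in the basis \<open>P\<close>: the
    shared corner blocks cancel, leaving a cross through the middle.\<close>
  define G0 where "G0 = block3_mat (0\<^sub>m p p) (F2 - E2) (0\<^sub>m p r) (F4 - E4) F5 F6 (0\<^sub>m r p) F8 (0\<^sub>m r r)"
  have G0c: "G0 \<in> carrier_mat n n" unfolding n G0_def by (rule block3_mat_carrier) (use B in auto)
  have BD: "F2 - E2 \<in> carrier_mat p q" "F4 - E4 \<in> carrier_mat q p"
    using B by (simp_all add: minus_carrier_mat)
  have right0: "A - 0\<^sub>m k l = A" if "A \<in> carrier_mat k l" for A :: "real mat" and k l
    using that by (intro eq_matI) auto
  have "?BF - ?BE = ?mid D2"
    using D by (subst block3_mat_minus[of _ p _ q _ r]) (simp_all add: mat_minus_self right0)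
  hence FE: "F - E = P * ?mid D2 * Q" unfolding E F using cs by (simp add: conj_minus[OF P Q])
  have "?BFe - ?BEe = G0"
    unfolding G0_def using B by (subst block3_mat_minus[of _ p _ q _ r]) (simp_all add: mat_minus_self right0)
  hence FE0: "F0 - E0 = P * G0 * Q" unfolding E0 F0 using cs by (simp add: conj_minus[OF P Q])
  \<comment> \<open>Inverting the middle block gives an inner inverse of \<open>F - E\<close>; its
    products with \<open>F - E\<close> on either side are the projector onto the middle
    block.\<close>
  define X where "X = P * ?mid D2' * Q"
  note mids = mid[OF D(2)] mid[OF D2'(1)] mid[OF one_carrier_mat]
  have GX: "(F - E) * X = P * ?mid (1\<^sub>m q) * Q" and XG: "X * (F - E) = P * ?mid (1\<^sub>m q) * Q"
    unfolding FE X_def using mids D D2' by (simp_all add: conj_mult[OF P Q QP] mid_mult)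
  have GXG: "(F - E) * X * (F - E) = F - E"
    unfolding GX unfolding FE using mids D by (simp add: conj_mult[OF P Q QP] mid_mult)
  \<comment> \<open>The complementary projector, which keeps the first and third blocks. Sandwiching
    \<open>G0\<close> between two copies of \<open>J\<close> retains only its four corners, and
    these are zero.\<close>
  define J where "J = block3_mat (1\<^sub>m p) (0\<^sub>m p q) (0\<^sub>m p r) (0\<^sub>m q p) (0\<^sub>m q q) (0\<^sub>m q r) (0\<^sub>m r p) (0\<^sub>m r q) (1\<^sub>m r :: real mat)"
  have Jc: "J \<in> carrier_mat n n" unfolding n J_def by (rule block3_mat_carrier) auto
  have "1\<^sub>m n - ?mid (1\<^sub>m q) = J"
    unfolding n block3_mat_one[symmetric] J_def
    by (subst block3_mat_minus[of _ p _ q _ r]) (simp_all add: mat_minus_self right0)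
  moreover have "1\<^sub>m n = P * 1\<^sub>m n * Q" using inv_mat_unique(3)[OF P Q QP] P by simp
  ultimately have K: "1\<^sub>m n - P * ?mid (1\<^sub>m q) * Q = P * J * Q"
    using conj_minus[OF P Q one_carrier_mat mids(3)] by simp
  have JG0: "J * G0 = block3_mat (0\<^sub>m p p) (F2 - E2) (0\<^sub>m p r) (0\<^sub>m q p) (0\<^sub>m q q) (0\<^sub>m q r) (0\<^sub>m r p) F8 (0\<^sub>m r r)"
    unfolding J_def G0_def using B BD by (subst block3_mat_mult[of _ p _ q _ r]) simp_all
  have "J * G0 * J = 0\<^sub>m n n"
    unfolding JG0 unfolding J_def n block3_mat_zero[symmetric]
    using B BD by (subst block3_mat_mult[of _ p _ q _ r]) simp_all
  moreover have "P * J * Q * (P * G0 * Q) * (P * J * Q) = P * (J * G0 * J) * Q"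
    unfolding conj_mult[OF P Q QP Jc G0c] by (rule conj_mult[OF P Q QP mult_carrier_mat[OF Jc G0c] Jc])
  ultimately have zero: "(1\<^sub>m n - (F - E) * X) * (F0 - E0) * (1\<^sub>m n - X * (F - E)) = 0\<^sub>m n n"
    unfolding GX XG K FE0 using P Q by simp
  have c: "E \<in> carrier_mat n n" "E0 \<in> carrier_mat n n" "F \<in> carrier_mat n n" "F0 \<in> carrier_mat n n"
    "X \<in> carrier_mat n n"
    unfolding E E0 F F0 X_def using P Q cs mids by auto
  show "\<exists>X. is_DMPGI (dual_mat F F0 - dual_mat E E0) X"
    unfolding dual_mat_minus[OF c(3,4,1,2)]
    using DMPGI_exists[OF _ _ c(5) GXG zero] c by (simp add: minus_carrier_mat)
qed

text \<open>The conjunct \<open>re \<le> rf\<close> ensures that the truncated difference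
  \<open>rf - re\<close> is a genuine block size; for \<open>n - rf\<close> this follows from the
  bound on the rank.\<close>

theorem theorem4p1:
  fixes n re rf :: nat and E E0 F F0 :: "real mat"
  assumes "E \<in> carrier_mat n n" "E0 \<in> carrier_mat n n"
    and "F \<in> carrier_mat n n" "F0 \<in> carrier_mat n n"
    and "dual_mat E E0 \<in> DCM n" "dual_mat F F0 \<in> DCM n"
    and "vec_space.rank n E = re" "vec_space.rank n F = rf"
  shows "dm_sharp_le n (dual_mat E E0) (dual_mat F F0) \<longleftrightarrow>
    re \<le> rf \<and>
    (\<exists>P \<in> carrier_mat n n. invertible_mat P \<and>
      (\<exists>D1 \<in> carrier_mat re re. \<exists>D2 \<in> carrier_mat (rf - re) (rf - re).
       \<exists>E1 \<in> carrier_mat re re. \<exists>E2 \<in> carrier_mat re (rf - re). \<exists>E3 \<in> carrier_mat re (n - rf).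
       \<exists>E4 \<in> carrier_mat (rf - re) re. \<exists>E7 \<in> carrier_mat (n - rf) re.
       \<exists>F2 \<in> carrier_mat re (rf - re). \<exists>F4 \<in> carrier_mat (rf - re) re.
       \<exists>F5 \<in> carrier_mat (rf - re) (rf - re). \<exists>F6 \<in> carrier_mat (rf - re) (n - rf).
       \<exists>F8 \<in> carrier_mat (n - rf) (rf - re).
         invertible_mat D1 \<and> invertible_mat D2 \<and>
         dual_mat E E0 =
           dual_mat
             (P * block3_mat
                    D1                  (0\<^sub>m re (rf - re))         (0\<^sub>m re (n - rf))
                    (0\<^sub>m (rf - re) re)  (0\<^sub>m (rf - re) (rf - re))  (0\<^sub>m (rf - re) (n - rf))
                    (0\<^sub>m (n - rf) re)   (0\<^sub>m (n - rf) (rf - re))   (0\<^sub>m (n - rf) (n - rf))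
                * inv_mat P)
             (P * block3_mat
                    E1  E2                         E3
                    E4  (0\<^sub>m (rf - re) (rf - re))  (0\<^sub>m (rf - re) (n - rf))
                    E7  (0\<^sub>m (n - rf) (rf - re))   (0\<^sub>m (n - rf) (n - rf))
                * inv_mat P) \<and>
         dual_mat F F0 =
           dual_mat
             (P * block3_mat
                    D1                  (0\<^sub>m re (rf - re))        (0\<^sub>m re (n - rf))
                    (0\<^sub>m (rf - re) re)  D2                        (0\<^sub>m (rf - re) (n - rf))
                    (0\<^sub>m (n - rf) re)   (0\<^sub>m (n - rf) (rf - re))  (0\<^sub>m (n - rf) (n - rf))
                * inv_mat P)
             (P * block3_mat
                    E1  F2  E3
                    F4  F5  F6
                    E7  F8  (0\<^sub>m (n - rf) (n - rf))
                * inv_mat P)))"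
proof -
  note E = assms(1,2) and F = assms(3,4) and GE = assms(5) and GF = assms(6)
  note rk = assms(7,8)
  have rf_n: "rf \<le> n" using vec_space.rank_le_nc[OF F(1)] rk by simp
  show ?thesis
  proof (intro iffI, goal_cases)
    case 1
    then obtain X where sharp: "E * F = E * E" "E * E = F * E"
      and X: "is_DMPGI (dual_mat F F0 - dual_mat E E0) X"
      by (auto simp: dm_sharp_le_def sharp_le_def std_part_dual_mat[OF E] std_part_dual_mat[OF F])
    from sharp_le_forward[OF E F GE GF sharp(1) sharp(2)[symmetric] X]
    obtain P Q p q r D1 D2 E1 E2 E3 E4 E7 F2 F4 F5 F6 F8 where
      n: "n = p + q + r" and re: "vec_space.rank n E = p" and rf: "vec_space.rank n F = p + q"
      and P: "P \<in> carrier_mat n n" and Q: "Q \<in> carrier_mat n n" and QP: "Q * P = 1\<^sub>m n"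
      and carriers: "D1 \<in> carrier_mat p p" "D2 \<in> carrier_mat q q"
        "E1 \<in> carrier_mat p p" "E2 \<in> carrier_mat p q" "E3 \<in> carrier_mat p r"
        "E4 \<in> carrier_mat q p" "E7 \<in> carrier_mat r p"
        "F2 \<in> carrier_mat p q" "F4 \<in> carrier_mat q p" "F5 \<in> carrier_mat q q"
        "F6 \<in> carrier_mat q r" "F8 \<in> carrier_mat r q"
      and inv: "invertible_mat D1" "invertible_mat D2"
      and eqs:
        "E = P * block3_mat D1 (0\<^sub>m p q) (0\<^sub>m p r) (0\<^sub>m q p) (0\<^sub>m q q) (0\<^sub>m q r) (0\<^sub>m r p) (0\<^sub>m r q) (0\<^sub>m r r) * Q"
        "E0 = P * block3_mat E1 E2 E3 E4 (0\<^sub>m q q) (0\<^sub>m q r) E7 (0\<^sub>m r q) (0\<^sub>m r r) * Q"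
        "F = P * block3_mat D1 (0\<^sub>m p q) (0\<^sub>m p r) (0\<^sub>m q p) D2 (0\<^sub>m q r) (0\<^sub>m r p) (0\<^sub>m r q) (0\<^sub>m r r) * Q"
        "F0 = P * block3_mat E1 F2 E3 F4 F5 F6 E7 F8 (0\<^sub>m r r) * Q" .
    have "p = re" "q = rf - re" "r = n - rf" using n re rf rk by simp_all
    note dims = this
    have "re \<le> rf" using re rf rk by simp
    \<comment> \<open>Rewrites the constructed inverse \<open>Q\<close> as \<open>inv_mat P\<close>,
      the form required by the statement.\<close>
    note PQ = inv_mat_unique(1)[OF P Q QP] inv_mat_unique(2)[OF P Q QP, symmetric]
    note eqs = eqs[unfolded dims PQ(2)] and carriers = carriers[unfolded dims]
    show ?case
      by (rule conjI, fact, rule bexI[OF _ P], rule conjI, rule PQ,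
          rule bexI[OF _ carriers(1)], rule bexI[OF _ carriers(2)], rule bexI[OF _ carriers(3)],
          rule bexI[OF _ carriers(4)], rule bexI[OF _ carriers(5)], rule bexI[OF _ carriers(6)],
          rule bexI[OF _ carriers(7)], rule bexI[OF _ carriers(8)], rule bexI[OF _ carriers(9)],
          rule bexI[OF _ carriers(10)], rule bexI[OF _ carriers(11)], rule bexI[OF _ carriers(12)])
        (intro conjI inv arg_cong2[where f = dual_mat] eqs)
  next
    case 2
    then show ?case
    proof (elim conjE bexE, goal_cases)
      case (1 P D1 D2 E1 E2 E3 E4 E7 F2 F4 F5 F6 F8)
      have n: "n = re + (rf - re) + (n - rf)" using 1(1) rf_n by simp
      have conj: "P * M * inv_mat P \<in> carrier_mat n n"
        if "M \<in> carrier_mat (re + (rf - re) + (n - rf)) (re + (rf - re) + (n - rf))" for M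
        using that inv_mat(1)[OF 1(2,3)] 1(2) n by (metis mult_carrier_mat)
      note z = zero_carrier_mat
      \<comment> \<open>Separating real and infinitesimal parts turns the two dual equations into
        the four real ones used by \<open>sharp_le_backward\<close>.\<close>
      note eqE = dual_mat_eqD[OF 1(18) E conj[OF block3_mat_carrier[OF 1(4) z z]]
          conj[OF block3_mat_carrier[OF 1(6) z z]]]
      note eqF = dual_mat_eqD[OF 1(19) F conj[OF block3_mat_carrier[OF 1(4,5) z]]
          conj[OF block3_mat_carrier[OF 1(6,13) z]]]
      note order = sharp_le_backward[OF n 1(2) inv_mat(1,3)[OF 1(2,3)] 1(4,5,17,6-15) eqE eqF]
      show ?case
        \<comment> \<open>The rank conditions inside \<open>sharp_le\<close> come from membership in
          \<open>DCM n\<close>, through \<open>rank_std_square\<close>.\<close>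
        unfolding dm_sharp_le_def sharp_le_def std_part_dual_mat[OF E] std_part_dual_mat[OF F]
        using E(1) F(1) GE GF order rank_std_square[OF E GE] rank_std_square[OF F GF] by simp
    qed
  qed
qed

end
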